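(* Let $\mathcal{V}$ be a variety. Then $\mathcal{V}$ is a non-Taylor variety if and only if there exist a non-empty set $T$ and sets $H_t$, $t\in T$, such that at least one of the $H_t$ is non-empty and the disjoint union $\dot\bigcup_{t\in T}\mathbb{C}^{H_t}$ is a compatible digraph in $\mathcal{V}$. Moreover, if $\mathcal{V}$ is a locally finite non-Taylor variety, then $T$ and the sets $H_t$, $t\in T$, can be chosen to be finite.
   Context: $\mathbb{C}$ is the digraph with vertices $0,1,2$ and edges $(0,1),(1,2),(2,0),(0,0),(1,1),(2,2)$. For a digraph $\mathbb{H}=(H,\to)$ and a set $I$, $\mathbb{H}^I$ is the digraph with vertex set $H^I$ and with $u\to v$ iff $u(i)\to v(i)$ for all $i\in I$ (so $\mathbb{H}^{\emptyset}$ is a one-element digraph with a loop). A digraph $\mathbb{G}$ is a compatible digraph in a variety $\mathcal{V}$ if there is an algebra $\mathbf{A}\in\mathcal{V}$ whose underlying set is the vertex set of $\mathbb{G}$ and all of whose basic operations preserve the edge relation of $\mathbb{G}$ (are polymorphisms of $\mathbb{G}$). A clone is a set of finitary operations on a set containing all projections and closed under composition. The clone of a variety is the clone of term operations of its free algebra on countably many free generators. A clone homomorphism sends each projection to the corresponding projection and commutes with composition. A variety $\mathcal{V}$ interprets in a variety $\mathcal{W}$ if there is a clone homomorphism from the clone of $\mathcal{V}$ to that of $\mathcal{W}$. A variety is idempotent if all operations $f$ in its clone satisfy $f(x,\dots,x)=x$. A strong Maltsev condition is a finite set $M$ of identities; a variety $\mathcal{V}$ admits $M$ if the variety defined by $M$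 interprets in $\mathcal{V}$; $M$ is idempotent if the variety defined by $M$ is idempotent, and trivial if the variety $\mathcal{SET}$ of algebras with no basic operations admits it. A Taylor variety is a variety that admits some non-trivial idempotent strong Maltsev condition; otherwise it is non-Taylor. *)

theory Defs
  imports
    Main
    "HOL-Library.FuncSet"
    "HOL-Library.NList"
    "Graph_Theory.Pair_Digraph"
begin

(* as simp rules, these loop together with nlists_def *)
declare nlistsE_length [simp del] nlistsE_set [simp del]

section \<open>Digraphs\<close>

definition C3 :: "nat pair_pre_digraph" where
  "C3 = \<lparr> pverts = {0, 1, 2}, parcs = {(0,1), (1,2), (2,0), (0,0), (1,1), (2,2)} \<rparr>"

definition digraph_power :: "'a pair_pre_digraph \<Rightarrow> 'i set \<Rightarrow> ('i \<Rightarrow> 'a) pair_pre_digraph" where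
  "digraph_power G I =
    \<lparr> pverts = I \<rightarrow>\<^sub>E pverts G,
      parcs = {(u, v). u \<in> I \<rightarrow>\<^sub>E pverts G \<and> v \<in> I \<rightarrow>\<^sub>E pverts G \<and> (\<forall>i\<in>I. (u i, v i) \<in> parcs G)} \<rparr>"

definition disjoint_union :: "'t set \<Rightarrow> ('t \<Rightarrow> 'a pair_pre_digraph) \<Rightarrow> ('t \<times> 'a) pair_pre_digraph" where
  "disjoint_union T G =
    \<lparr> pverts = (SIGMA t:T. pverts (G t)),
      parcs = {((t, u), (t, v)) | t u v. t \<in> T \<and> (u, v) \<in> parcs (G t)} \<rparr>"


section \<open>Terms, varieties and algebras\<close>

datatype (syms: 's, vars: 'v) trm = Var 'v | Op 's "('s, 'v) trm list"

primrec subst :: "('v \<Rightarrow> ('s, 'w) trm) \<Rightarrow> ('s, 'v) trm \<Rightarrow> ('s, 'w) trm" where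
  "subst \<sigma> (Var x) = \<sigma> x"
| "subst \<sigma> (Op f ts) = Op f (map (subst \<sigma>) ts)"

primrec eval :: "('s \<Rightarrow> 'a list \<Rightarrow> 'a) \<Rightarrow> ('v \<Rightarrow> 'a) \<Rightarrow> ('s, 'v) trm \<Rightarrow> 'a" where
  "eval I e (Var x) = e x"
| "eval I e (Op f ts) = I f (map (eval I e) ts)"

text \<open>
  A variety is the class of all algebras of a given signature that satisfy a given set of
  identities. It is represented by that signature and these identities. The set of operation
  symbols may be empty or infinite, and nullary symbols are allowed. Variables are natural numbers.
\<close>

record 's variety =
  opsyms :: "'s set"
  arity :: "'s \<Rightarrow> nat"
  idents :: "(('s, nat) trm \<times> ('s, nat) trm) set"

primrec wf_trm :: "'s variety \<Rightarrow> ('s, 'v) trm \<Rightarrow> bool" where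
  "wf_trm V (Var x) \<longleftrightarrow> True"
| "wf_trm V (Op f ts) \<longleftrightarrow> f \<in> opsyms V \<and> length ts = arity V f \<and> list_all (wf_trm V) ts"

definition wf_variety :: "'s variety \<Rightarrow> bool" where
  "wf_variety V \<longleftrightarrow> (\<forall>(s, t)\<in>idents V. wf_trm V s \<and> wf_trm V t)"

text \<open>
  The algebra with universe \<open>A\<close> and basic operations \<open>I f\<close>, where \<open>I f xs\<close> matters only
  for lists \<open>xs\<close> over \<open>A\<close> whose length is the arity of \<open>f\<close>. As usual, universes are non-empty.
\<close>

definition algebra_of :: "'s variety \<Rightarrow> 'a set \<Rightarrow> ('s \<Rightarrow> 'a list \<Rightarrow> 'a) \<Rightarrow> bool" where
  "algebra_of V A I \<longleftrightarrow>
    A \<noteq> {} \<and>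
    (\<forall>f\<in>opsyms V. \<forall>xs\<in>nlists (arity V f) A. I f xs \<in> A) \<and>
    (\<forall>(s, t)\<in>idents V. \<forall>e. range e \<subseteq> A \<longrightarrow> eval I e s = eval I e t)"

definition preserves :: "nat \<Rightarrow> ('a list \<Rightarrow> 'a) \<Rightarrow> 'a rel \<Rightarrow> bool" where
  "preserves n f R \<longleftrightarrow>
    (\<forall>xs ys. length xs = n \<and> length ys = n \<and> (\<forall>i<n. (xs ! i, ys ! i) \<in> R) \<longrightarrow> (f xs, f ys) \<in> R)"

definition compatible_digraph :: "'s variety \<Rightarrow> 'a pair_pre_digraph \<Rightarrow> bool" where
  "compatible_digraph V G \<longleftrightarrow>
    (\<exists>I. algebra_of V (pverts G) I \<and> (\<forall>f\<in>opsyms V. preserves (arity V f) (I f) (parcs G)))"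

definition subuniverse :: "'s variety \<Rightarrow> 'a set \<Rightarrow> ('s \<Rightarrow> 'a list \<Rightarrow> 'a) \<Rightarrow> 'a set \<Rightarrow> bool" where
  "subuniverse V A I B \<longleftrightarrow>
    B \<subseteq> A \<and> (\<forall>f\<in>opsyms V. \<forall>xs\<in>nlists (arity V f) B. I f xs \<in> B)"

definition finitely_generated :: "'s variety \<Rightarrow> 'a set \<Rightarrow> ('s \<Rightarrow> 'a list \<Rightarrow> 'a) \<Rightarrow> bool" where
  "finitely_generated V A I \<longleftrightarrow>
    (\<exists>X. finite X \<and> X \<subseteq> A \<and> (\<forall>B. subuniverse V A I B \<and> X \<subseteq> B \<longrightarrow> B = A))"

text \<open>
  Every finitely generated algebra is finite. Such an algebra is isomorphic to one whose elements
  are sets of terms, namely to a quotient of a term algebra, so quantifying over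
  algebras of that type loses nothing.
\<close>

definition locally_finite :: "'s variety \<Rightarrow> bool" where
  "locally_finite V \<longleftrightarrow>
    (\<forall>(A :: ('s, nat) trm set set) I. algebra_of V A I \<and> finitely_generated V A I \<longrightarrow> finite A)"


section \<open>The free algebra on countably many generators\<close>

text \<open>
  Terms modulo equational consequence (Birkhoff's rules). That this is the free algebra
  is confirmed by \<open>free_algebra_of\<close> and \<open>free_algebra_universal\<close> below.
\<close>

inductive eq_conseq :: "'s variety \<Rightarrow> ('s, nat) trm \<Rightarrow> ('s, nat) trm \<Rightarrow> bool" for V where
  ident: "(s, t) \<in> idents V \<Longrightarrow> (\<And>x. wf_trm V (\<sigma> x)) \<Longrightarrow> eq_conseq V (subst \<sigma> s) (subst \<sigma> t)"
| refl: "wf_trm V t \<Longrightarrow> eq_conseq V t t"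
| sym: "eq_conseq V s t \<Longrightarrow> eq_conseq V t s"
| trans: "eq_conseq V s t \<Longrightarrow> eq_conseq V t u \<Longrightarrow> eq_conseq V s u"
| cong: "f \<in> opsyms V \<Longrightarrow> length ss = arity V f \<Longrightarrow> list_all2 (eq_conseq V) ss ts
    \<Longrightarrow> eq_conseq V (Op f ss) (Op f ts)"

definition free_univ :: "'s variety \<Rightarrow> ('s, nat) trm set set" where
  "free_univ V = {t. wf_trm V t} // {(s, t). eq_conseq V s t}"

definition free_op :: "'s variety \<Rightarrow> 's \<Rightarrow> ('s, nat) trm set list \<Rightarrow> ('s, nat) trm set" where
  "free_op V f cs = {t. \<exists>ts. list_all2 (\<in>) ts cs \<and> eq_conseq V (Op f ts) t}"

definition free_gen :: "'s variety \<Rightarrow> nat \<Rightarrow> ('s, nat) trm set" where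
  "free_gen V i = {t. eq_conseq V (Var i) t}"

lemma wf_subst:
  "wf_trm V t \<Longrightarrow> (\<And>x. wf_trm V (\<sigma> x)) \<Longrightarrow> wf_trm V (subst \<sigma> t)"
  by (induction t) (auto simp: list_all_iff)

lemma eq_conseq_wf:
  assumes "wf_variety V" "eq_conseq V s t" shows "wf_trm V s \<and> wf_trm V t"
  using assms(2)
proof induction
  case (ident s t \<sigma>)
  then show ?case using assms(1) by (auto simp: wf_variety_def intro!: wf_subst)
next
  case (cong f ss ts)
  then show ?case by (auto simp: list_all_length list_all2_conv_all_nth)
qed auto

lemma eq_class_eq: "eq_conseq V s t \<Longrightarrow> {u. eq_conseq V s u} = {u. eq_conseq V t u}"
  by (blast intro: eq_conseq.sym eq_conseq.trans)

lemma free_univ_eq: "free_univ V = (\<lambda>t. {u. eq_conseq V t u}) ` {t. wf_trm V t}"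
  by (auto simp: free_univ_def quotient_def)

lemma free_gen_in: "free_gen V i \<in> free_univ V"
  by (auto simp: free_univ_eq free_gen_def)

lemma free_op_classes:
  assumes "f \<in> opsyms V" "length ts = arity V f" "list_all (wf_trm V) ts"
  shows "free_op V f (map (\<lambda>t. {u. eq_conseq V t u}) ts) = {u. eq_conseq V (Op f ts) u}"
proof (intro set_eqI iffI)
  fix u assume "u \<in> free_op V f (map (\<lambda>t. {u. eq_conseq V t u}) ts)"
  then obtain ss where ss: "list_all2 (\<in>) ss (map (\<lambda>t. {u. eq_conseq V t u}) ts)"
    and u: "eq_conseq V (Op f ss) u" unfolding free_op_def by blast
  from ss have "list_all2 (eq_conseq V) ts ss" by (auto simp: list_all2_conv_all_nth)
  then have "eq_conseq V (Op f ts) (Op f ss)" using assms by (intro eq_conseq.cong)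
  with u show "u \<in> {u. eq_conseq V (Op f ts) u}" by (auto intro: eq_conseq.trans)
next
  fix u assume "u \<in> {u. eq_conseq V (Op f ts) u}"
  moreover have "list_all2 (\<in>) ts (map (\<lambda>t. {u. eq_conseq V t u}) ts)"
    using assms by (auto simp: list_all2_conv_all_nth list_all_length intro: eq_conseq.refl)
  ultimately show "u \<in> free_op V f (map (\<lambda>t. {u. eq_conseq V t u}) ts)"
    unfolding free_op_def by blast
qed

lemma eval_free:
  assumes "wf_trm V t" "\<And>x. wf_trm V (\<sigma> x)"
  shows "eval (free_op V) (\<lambda>x. {u. eq_conseq V (\<sigma> x) u}) t = {u. eq_conseq V (subst \<sigma> t) u}"
  using assms(1)
proof (induction t)
  case (Op f ts)
  then have *: "map (eval (free_op V) (\<lambda>x. {u. eq_conseq V (\<sigma> x) u})) ts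
      = map (\<lambda>t. {u. eq_conseq V t u}) (map (subst \<sigma>) ts)"
    by (auto simp: list_all_iff)
  have wf: "list_all (wf_trm V) (map (subst \<sigma>) ts)"
    using Op.prems assms(2) by (auto simp: list_all_iff intro!: wf_subst)
  have "f \<in> opsyms V" "length (map (subst \<sigma>) ts) = arity V f" using Op.prems by auto
  from free_op_classes[OF this wf] show ?case by (simp only: eval.simps subst.simps *)
qed simp

lemma free_univ_family:
  assumes "range e \<subseteq> free_univ V"
  shows "\<exists>\<sigma>. (\<forall>x. wf_trm V (\<sigma> x)) \<and> e = (\<lambda>x. {u. eq_conseq V (\<sigma> x) u})"
proof -
  have "\<forall>x. \<exists>t. wf_trm V t \<and> e x = {u. eq_conseq V t u}"
    using assms unfolding free_univ_eq by blast
  from choice[OF this] obtain \<sigma> where "\<forall>x. wf_trm V (\<sigma> x) \<and> e x = {u. eq_conseq V (\<sigma> x) u}" ..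
  then show ?thesis by (intro exI[of _ \<sigma>]) (simp add: fun_eq_iff)
qed

lemma free_univ_list:
  assumes "set cs \<subseteq> free_univ V"
  shows "\<exists>ts. list_all (wf_trm V) ts \<and> cs = map (\<lambda>t. {u. eq_conseq V t u}) ts"
  using assms
proof (induction cs)
  case (Cons c cs)
  then obtain ts t where "list_all (wf_trm V) ts" "cs = map (\<lambda>t. {u. eq_conseq V t u}) ts"
    "wf_trm V t" "c = {u. eq_conseq V t u}" by (auto simp: free_univ_eq)
  then show ?case by (intro exI[of _ "t # ts"]) simp
qed simp

lemma free_op_closed:
  assumes "f \<in> opsyms V" "cs \<in> nlists (arity V f) (free_univ V)"
  shows "free_op V f cs \<in> free_univ V"
proof -
  from assms(2) have len: "length cs = arity V f" and sub: "set cs \<subseteq> free_univ V"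
    by (auto simp: nlists_def)
  obtain ts where ts: "list_all (wf_trm V) ts" "cs = map (\<lambda>t. {u. eq_conseq V t u}) ts"
    using free_univ_list[OF sub] by blast
  then have l: "length ts = arity V f" using len by simp
  have "free_op V f cs = {u. eq_conseq V (Op f ts) u}"
    unfolding ts(2) by (rule free_op_classes[OF assms(1) l ts(1)])
  moreover have "wf_trm V (Op f ts)" using l ts(1) assms(1) by simp
  ultimately show ?thesis unfolding free_univ_eq by blast
qed

lemma free_algebra_of:
  fixes V :: "'a variety"
  assumes "wf_variety V" shows "algebra_of V (free_univ V) (free_op V)"
  unfolding algebra_of_def
proof (intro conjI)
  show "free_univ V \<noteq> {}" using free_gen_in[of V 0] by auto
  show "\<forall>f\<in>opsyms V. \<forall>xs\<in>nlists (arity V f) (free_univ V). free_op V f xs \<in> free_univ V"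
    by (intro ballI free_op_closed)
  show "\<forall>(s, t)\<in>idents V. \<forall>e. range e \<subseteq> free_univ V \<longrightarrow> eval (free_op V) e s = eval (free_op V) e t"
  proof clarify
    fix s t and e :: "nat \<Rightarrow> ('a, nat) trm set" assume st: "(s, t) \<in> idents V" and e: "range e \<subseteq> free_univ V"
    obtain \<sigma> where \<sigma>: "\<forall>x. wf_trm V (\<sigma> x)" and e_eq: "e = (\<lambda>x. {u. eq_conseq V (\<sigma> x) u})"
      using free_univ_family[OF e] by (elim exE conjE)
    have \<sigma>': "wf_trm V (\<sigma> x)" for x using \<sigma> ..
    have wf: "wf_trm V s" "wf_trm V t" using assms st by (auto simp: wf_variety_def)
    show "eval (free_op V) e s = eval (free_op V) e t"
      unfolding e_eq eval_free[OF wf(1) \<sigma>'] eval_free[OF wf(2) \<sigma>']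
      by (rule eq_class_eq, rule eq_conseq.ident[OF st \<sigma>'])
  qed
qed

lemma eval_in_universe:
  assumes "algebra_of V A I" "range e \<subseteq> A" "wf_trm V t" shows "eval I e t \<in> A"
  using assms(3)
proof (induction t)
  case (Op f ts)
  then have "map (eval I e) ts \<in> nlists (arity V f) A"
    by (auto simp: nlists_def list_all_iff)
  moreover have "f \<in> opsyms V" using Op.prems by simp
  ultimately show ?case using assms(1) by (simp add: algebra_of_def)
qed (use assms(2) in \<open>simp add: image_subset_iff\<close>)

lemma eval_cong: "(\<And>x. x \<in> vars t \<Longrightarrow> d x = e x) \<Longrightarrow> eval I d t = eval I e t"
proof (induction t)
  case (Op f ts)
  then have "map (eval I d) ts = map (eval I e) ts"
    by (intro map_cong Op.IH Op.prems) auto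
  then show ?case by (simp only: eval.simps)
qed simp

lemma eval_subst: "eval I e (subst \<sigma> t) = eval I (\<lambda>x. eval I e (\<sigma> x)) t"
  by (induction t) (simp_all cong: map_cong)

lemma eq_conseq_sound:
  assumes "algebra_of V A I" "range e \<subseteq> A" "eq_conseq V s t"
  shows "eval I e s = eval I e t"
  using assms(3)
proof induction
  case (ident s t \<sigma>)
  have "range (\<lambda>x. eval I e (\<sigma> x)) \<subseteq> A"
    using eval_in_universe[OF assms(1,2) ident(2)] by (simp add: image_subset_iff)
  moreover have "\<forall>(s, t)\<in>idents V. \<forall>e. range e \<subseteq> A \<longrightarrow> eval I e s = eval I e t"
    using assms(1) unfolding algebra_of_def by (elim conjE)
  ultimately have "eval I (\<lambda>x. eval I e (\<sigma> x)) s = eval I (\<lambda>x. eval I e (\<sigma> x)) t"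
    using ident(1) by blast
  then show ?case by (simp only: eval_subst)
next
  case (cong f ss ts)
  then have "list_all2 (\<lambda>s t. eval I e s = eval I e t) ss ts"
    by (auto elim: list_all2_mono)
  then have "map (eval I e) ss = map (eval I e) ts"
    by (simp add: list_all2_conv_all_nth list_eq_iff_nth_eq)
  then show ?case by simp
qed simp_all

lemma free_algebra_universal:
  fixes e :: "nat \<Rightarrow> 'a"
  assumes "wf_variety V" "algebra_of V A I" "range e \<subseteq> A"
  shows "\<exists>!h. h \<in> free_univ V \<rightarrow>\<^sub>E A \<and> (\<forall>i. h (free_gen V i) = e i) \<and>
    (\<forall>f\<in>opsyms V. \<forall>cs\<in>nlists (arity V f) (free_univ V). h (free_op V f cs) = I f (map h cs))"
    (is "\<exists>!h. ?P h")
proof -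
  let ?cl = "\<lambda>t. {u. eq_conseq V t u}"
  define h where "h = (\<lambda>c\<in>free_univ V. eval I e (SOME t. t \<in> c))"
  have h_cl: "h (?cl t) = eval I e t" if "wf_trm V t" for t
  proof -
    have "t \<in> ?cl t" using that by (auto intro: eq_conseq.refl)
    then have "eq_conseq V t (SOME u. u \<in> ?cl t)" by (metis mem_Collect_eq someI_ex)
    from eq_conseq_sound[OF assms(2,3) this] have "eval I e (SOME u. u \<in> ?cl t) = eval I e t" by simp
    moreover have "?cl t \<in> free_univ V" using that unfolding free_univ_eq by blast
    ultimately show ?thesis by (simp add: h_def)
  qed
  have "?P h"
  proof (intro conjI ballI allI)
    show "h \<in> free_univ V \<rightarrow>\<^sub>E A"
    proof (rule PiE_I)
      fix c assume "c \<in> free_univ V"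
      then obtain t where "wf_trm V t" "c = ?cl t" unfolding free_univ_eq by blast
      then show "h c \<in> A" using h_cl eval_in_universe[OF assms(2,3)] by simp
    qed (simp add: h_def)
    show "h (free_gen V i) = e i" for i using h_cl[of "Var i"] by (simp add: free_gen_def)
  next
    fix f cs assume f: "f \<in> opsyms V" and cs: "cs \<in> nlists (arity V f) (free_univ V)"
    then have "set cs \<subseteq> free_univ V" by (simp add: nlists_def)
    then obtain ts where ts: "list_all (wf_trm V) ts" "cs = map ?cl ts"
      using free_univ_list by blast
    with cs have len: "length ts = arity V f" by (auto simp: nlists_def)
    have "h (free_op V f cs) = eval I e (Op f ts)"
      unfolding ts(2) free_op_classes[OF f len ts(1)] using f len ts(1) by (intro h_cl) auto
    moreover have "map h cs = map (eval I e) ts" using ts h_cl by (auto simp: list_all_iff)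
    ultimately show "h (free_op V f cs) = I f (map h cs)" by simp
  qed
  moreover have "g = h" if g: "?P g" for g
  proof -
    have "g (?cl t) = eval I e t" if "wf_trm V t" for t
      using that
    proof (induction t)
      case (Var x)
      have "g (free_gen V x) = e x" using g by blast
      then show ?case by (simp add: free_gen_def)
    next
      case (Op f ts)
      then have f: "f \<in> opsyms V" "length ts = arity V f" "list_all (wf_trm V) ts" by auto
      then have "map ?cl ts \<in> nlists (arity V f) (free_univ V)"
        by (auto simp: nlists_def free_univ_eq list_all_iff)
      then have "g (free_op V f (map ?cl ts)) = I f (map g (map ?cl ts))" using g f(1) by blast
      moreover have "map g (map ?cl ts) = map (eval I e) ts" using Op f(3) by (auto simp: list_all_iff)
      ultimately show ?case by (simp only: free_op_classes[OF f] eval.simps)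
    qed
    then have eq: "g c = h c" if "c \<in> free_univ V" for c
      using that h_cl unfolding free_univ_eq by force
    have "g \<in> free_univ V \<rightarrow>\<^sub>E A" "h \<in> free_univ V \<rightarrow>\<^sub>E A" using g \<open>?P h\<close> by blast+
    then show "g = h" using eq by (rule PiE_ext)
  qed
  ultimately show ?thesis by (rule ex1I)
qed


section \<open>Clones and interpretations\<close>

text \<open>
  An \<open>n\<close>-ary operation on \<open>A\<close> is a function on lists of length \<open>n\<close> over \<open>A\<close>, undefined elsewhere.
  A clone is given by its sets of \<open>n\<close>-ary operations. Only arities \<open>n \<ge> 1\<close> are considered; a
  constant of an algebra contributes its constant operations of positive arity.
\<close>

definition projection :: "'a set \<Rightarrow> nat \<Rightarrow> nat \<Rightarrow> 'a list \<Rightarrow> 'a" where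
  "projection A n i = (\<lambda>xs\<in>nlists n A. xs ! i)"

definition composition :: "'a set \<Rightarrow> nat \<Rightarrow> ('a list \<Rightarrow> 'a) \<Rightarrow> ('a list \<Rightarrow> 'a) list \<Rightarrow> 'a list \<Rightarrow> 'a" where
  "composition A n f gs = (\<lambda>xs\<in>nlists n A. f (map (\<lambda>g. g xs) gs))"

definition is_clone :: "'a set \<Rightarrow> (nat \<Rightarrow> ('a list \<Rightarrow> 'a) set) \<Rightarrow> bool" where
  "is_clone A C \<longleftrightarrow>
    (\<forall>n\<ge>1. C n \<subseteq> nlists n A \<rightarrow>\<^sub>E A) \<and>
    (\<forall>n\<ge>1. \<forall>i<n. projection A n i \<in> C n) \<and>
    (\<forall>m\<ge>1. \<forall>n\<ge>1. \<forall>f\<in>C m. \<forall>gs\<in>nlists m (C n). composition A n f gs \<in> C n)"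

definition clone_hom ::
  "'a set \<Rightarrow> (nat \<Rightarrow> ('a list \<Rightarrow> 'a) set) \<Rightarrow> 'b set \<Rightarrow> (nat \<Rightarrow> ('b list \<Rightarrow> 'b) set) \<Rightarrow>
    (nat \<Rightarrow> ('a list \<Rightarrow> 'a) \<Rightarrow> ('b list \<Rightarrow> 'b)) \<Rightarrow> bool" where
  "clone_hom A C B D \<phi> \<longleftrightarrow>
    (\<forall>n\<ge>1. \<forall>f\<in>C n. \<phi> n f \<in> D n) \<and>
    (\<forall>n\<ge>1. \<forall>i<n. \<phi> n (projection A n i) = projection B n i) \<and>
    (\<forall>m\<ge>1. \<forall>n\<ge>1. \<forall>f\<in>C m. \<forall>gs\<in>nlists m (C n).
      \<phi> n (composition A n f gs) = composition B n (\<phi> m f) (map (\<phi> n) gs))"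

definition variety_clone :: "'s variety \<Rightarrow> nat \<Rightarrow> (('s, nat) trm set list \<Rightarrow> ('s, nat) trm set) set" where
  "variety_clone V n =
    {\<lambda>xs\<in>nlists n (free_univ V). eval (free_op V) (\<lambda>i. xs ! i) t | t :: ('s, nat) trm.
      wf_trm V t \<and> vars t \<subseteq> {..<n}}"

lemma is_clone_variety_clone:
  assumes "wf_variety V" shows "is_clone (free_univ V) (variety_clone V)"
proof -
  let ?A = "free_univ V" and ?I = "free_op V"
  let ?top = "\<lambda>n t. \<lambda>xs\<in>nlists n ?A. eval ?I (\<lambda>i. xs ! i) t"
  have vars_subst: "vars (subst \<sigma> t) \<subseteq> (\<Union>i\<in>vars t. vars (\<sigma> i))" for \<sigma> :: "nat \<Rightarrow> ('a, nat) trm" and t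
    by (induction t) fastforce+
  have in_univ: "?top n t xs \<in> ?A"
    if "xs \<in> nlists n ?A" "wf_trm V t" "vars t \<subseteq> {..<n}" for n t xs
  proof -
    let ?e = "\<lambda>i. if i < n then xs ! i else free_gen V 0"
    have "range ?e \<subseteq> ?A" using that(1) free_gen_in by (auto simp: nlists_def)
    then have "eval ?I ?e t \<in> ?A"
      by (rule eval_in_universe[OF free_algebra_of[OF assms] _ that(2)])
    moreover have "eval ?I ?e t = eval ?I (\<lambda>i. xs ! i) t" using that(3) by (intro eval_cong) auto
    ultimately show ?thesis using that(1) by simp
  qed
  show ?thesis
    unfolding is_clone_def
  proof (intro conjI allI impI ballI)
    fix n :: nat
    show "variety_clone V n \<subseteq> nlists n ?A \<rightarrow>\<^sub>E ?A"
      unfolding variety_clone_def using in_univ by (fastforce simp: PiE_def)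
  next
    fix n i :: nat assume "i < n"
    then show "projection ?A n i \<in> variety_clone V n"
      unfolding variety_clone_def projection_def by (intro CollectI exI[of _ "Var i"]) auto
  next
    fix m n :: nat and f gs
    assume f: "f \<in> variety_clone V m" and gs: "gs \<in> nlists m (variety_clone V n)"
    obtain t where t: "f = ?top m t" "wf_trm V t" "vars t \<subseteq> {..<m}"
      using f by (auto simp: variety_clone_def)
    have len: "length gs = m" using gs by (auto simp: nlists_def)
    have "\<forall>i<m. \<exists>s. gs ! i = ?top n s \<and> wf_trm V s \<and> vars s \<subseteq> {..<n}"
    proof (intro allI impI)
      fix i assume "i < m"
      then have "gs ! i \<in> variety_clone V n" using gs len by (auto simp: nlists_def)
      then show "\<exists>s. gs ! i = ?top n s \<and> wf_trm V s \<and> vars s \<subseteq> {..<n}"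
        by (auto simp: variety_clone_def)
    qed
    then obtain r where r: "\<And>i. i < m \<Longrightarrow> gs ! i = ?top n (r i) \<and> wf_trm V (r i) \<and> vars (r i) \<subseteq> {..<n}"
      by metis
    let ?\<sigma> = "\<lambda>i. if i < m then r i else Var i"
    have "wf_trm V (subst ?\<sigma> t)" using t(2) r by (intro wf_subst) auto
    moreover have "vars (subst ?\<sigma> t) \<subseteq> {..<n}" using vars_subst[of ?\<sigma> t] t(3) r by fastforce
    moreover have "composition ?A n f gs = ?top n (subst ?\<sigma> t)"
      unfolding composition_def
    proof (rule restrict_ext)
      fix xs assume xs: "xs \<in> nlists n ?A"
      let ?ys = "map (\<lambda>g. g xs) gs"
      have "?ys \<in> nlists m ?A"
        using len r in_univ[OF xs] xs by (auto simp: nlists_def in_set_conv_nth)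
      then have "f ?ys = eval ?I (\<lambda>i. ?ys ! i) t" using t(1) by simp
      also have "\<dots> = eval ?I (\<lambda>i. eval ?I (\<lambda>i. xs ! i) (?\<sigma> i)) t"
        using t(3) len r xs by (intro eval_cong) auto
      finally show "f ?ys = eval ?I (\<lambda>i. xs ! i) (subst ?\<sigma> t)" by (simp add: eval_subst)
    qed
    ultimately show "composition ?A n f gs \<in> variety_clone V n"
      unfolding variety_clone_def by blast
  qed
qed

definition interprets :: "'s variety \<Rightarrow> 'r variety \<Rightarrow> bool" where
  "interprets V W \<longleftrightarrow>
    (\<exists>\<phi>. clone_hom (free_univ V) (variety_clone V) (free_univ W) (variety_clone W) \<phi>)"

definition idempotent_variety :: "'s variety \<Rightarrow> bool" where
  "idempotent_variety V \<longleftrightarrow>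
    (\<forall>n\<ge>1. \<forall>f\<in>variety_clone V n. \<forall>x\<in>free_univ V. f (replicate n x) = x)"


section \<open>Strong Maltsev conditions\<close>

text \<open>
  A finite set of identities involves only finitely many operation symbols, so these may be
  taken to be natural numbers; \<open>a\<close> gives their arities.
\<close>

type_synonym identities = "((nat, nat) trm \<times> (nat, nat) trm) set"

definition defined_by :: "(nat \<Rightarrow> nat) \<Rightarrow> identities \<Rightarrow> nat variety" where
  "defined_by a M =
    \<lparr> opsyms = (\<Union>(s, t)\<in>M. syms s \<union> syms t), arity = a, idents = M \<rparr>"

definition strong_Maltsev :: "(nat \<Rightarrow> nat) \<Rightarrow> identities \<Rightarrow> bool" where
  "strong_Maltsev a M \<longleftrightarrow> finite M \<and> wf_variety (defined_by a M)"

definition admits :: "'s variety \<Rightarrow> (nat \<Rightarrow> nat) \<Rightarrow> identities \<Rightarrow> bool" where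
  "admits V a M \<longleftrightarrow> interprets (defined_by a M) V"

definition SET :: "nat variety" where
  "SET = \<lparr> opsyms = {}, arity = (\<lambda>_. 0), idents = {} \<rparr>"

definition Taylor :: "'s variety \<Rightarrow> bool" where
  "Taylor V \<longleftrightarrow>
    (\<exists>a M. strong_Maltsev a M \<and> idempotent_variety (defined_by a M) \<and>
      \<not> admits SET a M \<and> admits V a M)"

end

theory Submission
  imports Defs "HOL-Library.Nat_Bijection" "HOL-Analysis.Function_Topology"
begin

text \<open>
  Let \<open>V\<close> be non-Taylor. The components of the required digraph are indexed by the terms in one
  variable, up to the identities of \<open>V\<close>; such a class arises as the \<^emph>\<open>diagonal\<close> of every term
  that becomes a member of it when all variables are identified. A \<^emph>\<open>chooser\<close> for a diagonal
  picks one variable in each term with this diagonal, compatibly with renaming of variables and with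
  the identities; it is a homomorphism from these terms, viewed as a minion, to the projections. A
  chooser for the diagonal of a single variable satisfies all height one identities between
  idempotent terms by projections. Non-Taylor means that this can be done for finitely many
  identities at a time, so compactness provides such a chooser (\<open>non_Taylor_chooser\<close>).

  The construction rests on an independence property (\<open>chooser_independent\<close>). Apply a chooser
  \<open>\<alpha>\<close> to \<open>f(p\<^sub>1, \<dots>, p\<^sub>n)\<close>, with the variables of the \<open>p\<^sub>j\<close> made disjoint. The chosen variable lies in
  some \<open>p\<^sub>i\<close>, and collapsing the variables of each \<open>p\<^sub>j\<close> shows that \<open>i\<close> depends only on the diagonals.
  Collapsing only the \<open>p\<^sub>j\<close> with \<open>j \<noteq> i\<close> keeps the chosen variable, so it depends on these \<open>p\<^sub>j\<close>
  only through their diagonals. Hence \<open>\<alpha>\<close> determines an argument \<open>i\<close> and a derived chooser \<open>\<beta>\<close> for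
  the diagonal of \<open>p\<^sub>i\<close>. With \<open>H\<^sub>r\<close> the set of choosers for the diagonal \<open>r\<close>, the operation
  \<open>f(x\<^sub>1, \<dots>, x\<^sub>n)(\<alpha>) = x\<^sub>i(\<beta>)\<close> turns the disjoint union of the powers \<open>X\<^bsup>H\<^sub>r\<^esup>\<close> into an algebra
  in \<open>V\<close>, for any non-empty set \<open>X\<close> (\<open>eval_power_op_ident\<close>). Each coordinate of a value is a coordinate of
  an argument, so every digraph on \<open>X\<close> yields a compatible one (\<open>compatible_power_digraph\<close>).

  For the finiteness claim, choosers are replaced by their restrictions to terms in two variables,
  called profiles below. A restriction still determines \<open>i\<close> and the restriction of \<open>\<beta>\<close>, and a
  locally finite variety has only finitely many terms in two variables up to its identities.

  Conversely, let a union of powers of the reflexive 3-cycle be compatible in \<open>V\<close>. Idempotent terms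
  preserve components. A coordinate of an idempotent term operation on a power is an edge-preserving
  map \<open>F\<close> from a power of the 3-cycle to the 3-cycle. Adding 1 modulo 3 on a set \<open>S\<close> of coordinates
  either changes \<open>F\<close> everywhere or nowhere, and two disjoint sets cannot both change it, since
  \<open>F\<close> would then move by 2 along an edge. Hence \<open>F\<close> depends on the coordinates of one argument of the
  term only and, by idempotence, the term acts as a projection there (\<open>idempotent_acts\<close>). Any
  idempotent condition that \<open>V\<close> admits is therefore satisfied by projections (\<open>not_Taylor\<close>).
\<close>

section \<open>Substitution and equational consequence\<close>

abbreviation rename :: "(nat \<Rightarrow> nat) \<Rightarrow> ('s, nat) trm \<Rightarrow> ('s, nat) trm" where
  "rename \<sigma> \<equiv> subst (\<lambda>x. Var (\<sigma> x))"

definition term_class :: "'s variety \<Rightarrow> ('s, nat) trm \<Rightarrow> ('s, nat) trm set" where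
  "term_class V t = {u. eq_conseq V t u}"

text \<open>
  The diagonal of a term is the unary term obtained by identifying all variables. It is formed by
  renaming every variable to 0.
\<close>

definition same_diag :: "'s variety \<Rightarrow> ('s, nat) trm \<Rightarrow> ('s, nat) trm \<Rightarrow> bool" where
  "same_diag V s t \<longleftrightarrow> wf_trm V s \<and> wf_trm V t \<and>
    eq_conseq V (rename (\<lambda>_. 0) s) (rename (\<lambda>_. 0) t)"

lemma subst_subst: "subst \<sigma> (subst \<tau> t) = subst (\<lambda>x. subst \<sigma> (\<tau> x)) t"
  by (induction t) simp_all

lemma subst_Var [simp]: "subst Var t = t"
  by (induction t) (simp_all cong: map_cong)

lemma subst_cong: "(\<And>x. x \<in> vars t \<Longrightarrow> \<sigma> x = \<tau> x) \<Longrightarrow> subst \<sigma> t = subst \<tau> t"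
  by (induction t) (auto intro!: map_cong)

lemma vars_subst: "vars (subst \<sigma> t) = (\<Union>x\<in>vars t. vars (\<sigma> x))"
  by (induction t) auto

lemma finite_vars [simp]: "finite (vars t)"
  by (induction t) auto

lemma eq_conseq_subst:
  assumes "eq_conseq V s t" "\<And>x. wf_trm V (\<sigma> x)"
  shows "eq_conseq V (subst \<sigma> s) (subst \<sigma> t)"
  using assms(1)
proof induction
  case (ident s t \<tau>)
  then show ?case
    unfolding subst_subst by (intro eq_conseq.ident wf_subst assms(2))
next
  case (refl t)
  then show ?case by (intro eq_conseq.refl wf_subst assms(2))
next
  case (sym s t)
  then show ?case by (blast intro: eq_conseq.sym)
next
  case (trans s t u)
  then show ?case by (blast intro: eq_conseq.trans)
next
  case (cong f ss ts)
  then show ?case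
    by (auto intro!: eq_conseq.cong simp: list_all2_conv_all_nth)
qed

lemma eq_conseq_subst_cong:
  assumes "wf_trm V t" "\<And>x. x \<in> vars t \<Longrightarrow> eq_conseq V (\<sigma> x) (\<tau> x)"
  shows "eq_conseq V (subst \<sigma> t) (subst \<tau> t)"
  using assms
proof (induction t)
  case (Op f ts)
  have "eq_conseq V (subst \<sigma> s) (subst \<tau> s)" if "s \<in> set ts" for s
    using that Op.prems by (intro Op.IH) (auto simp: list_all_iff)
  then show ?case
    using Op.prems(1) by (auto intro!: eq_conseq.cong simp: list_all2_conv_all_nth)
qed auto

lemma term_class_eq_iff:
  assumes "wf_trm V t"
  shows "term_class V s = term_class V t \<longleftrightarrow> eq_conseq V s t"
  using assms unfolding term_class_def
  by (blast intro: eq_conseq.sym eq_conseq.trans eq_conseq.refl)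

lemma wf_rename [simp]: "wf_trm V t \<Longrightarrow> wf_trm V (rename \<sigma> t)"
  by (simp add: wf_subst)

lemma same_diag_refl: "wf_trm V t \<Longrightarrow> same_diag V t t"
  by (simp add: same_diag_def eq_conseq.refl)

lemma same_diag_sym: "same_diag V s t \<Longrightarrow> same_diag V t s"
  by (auto simp: same_diag_def intro: eq_conseq.sym)

lemma same_diag_trans: "same_diag V s t \<Longrightarrow> same_diag V t u \<Longrightarrow> same_diag V s u"
  by (auto simp: same_diag_def intro: eq_conseq.trans)

lemma same_diag_rename: "wf_trm V t \<Longrightarrow> same_diag V t (rename \<sigma> t)"
  by (simp add: same_diag_def subst_subst eq_conseq.refl)

lemma same_diag_at:
  assumes "same_diag V s t"
  shows "eq_conseq V (rename (\<lambda>_. x) s) (rename (\<lambda>_. x) t)"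
proof -
  have "eq_conseq V (rename (\<lambda>_. x) (rename (\<lambda>_. 0) s)) (rename (\<lambda>_. x) (rename (\<lambda>_. 0) t))"
    by (rule eq_conseq_subst) (use assms in \<open>simp_all add: same_diag_def\<close>)
  then show ?thesis by (simp add: subst_subst)
qed

lemma same_diag_subst:
  assumes "wf_trm V t" "\<And>x. wf_trm V (\<sigma> x)" "\<And>x. wf_trm V (\<tau> x)"
    "\<And>x. x \<in> vars t \<Longrightarrow> same_diag V (\<sigma> x) (\<tau> x)"
  shows "same_diag V (subst \<sigma> t) (subst \<tau> t)"
proof -
  have "eq_conseq V (subst (\<lambda>x. rename (\<lambda>_. 0) (\<sigma> x)) t) (subst (\<lambda>x. rename (\<lambda>_. 0) (\<tau> x)) t)"
    using assms(1) by (rule eq_conseq_subst_cong) (use assms(4) in \<open>simp add: same_diag_def\<close>)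
  then show ?thesis
    using wf_subst[OF assms(1,2)] wf_subst[OF assms(1,3)] by (simp add: same_diag_def subst_subst)
qed

context
  fixes V :: "'s variety"
  assumes wf: "wf_variety V"
begin

lemma eq_conseq_same_diag:
  assumes "eq_conseq V s t" shows "same_diag V s t"
proof -
  have "eq_conseq V (rename (\<lambda>_. 0) s) (rename (\<lambda>_. 0) t)"
    using assms by (rule eq_conseq_subst) simp
  then show ?thesis using eq_conseq_wf[OF wf assms] by (simp add: same_diag_def)
qed

end

section \<open>Choosers\<close>

text \<open>
  A homomorphism from the terms with the diagonal of \<open>r\<close> to the projections. The value of \<open>\<alpha>\<close> at a
  term is a variable, that is, a natural number. Renaming and equational consequence are combined in
  one condition; the values of \<open>\<alpha>\<close> at terms with other diagonals are unconstrained.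
\<close>

definition chooser :: "'s variety \<Rightarrow> ('s, nat) trm \<Rightarrow> (('s, nat) trm \<Rightarrow> nat) \<Rightarrow> bool" where
  "chooser V r \<alpha> \<longleftrightarrow>
    (\<forall>s t \<sigma>. same_diag V r s \<and> eq_conseq V (rename \<sigma> s) t \<longrightarrow> \<alpha> t = \<sigma> (\<alpha> s))"

lemma chooser_rename:
  assumes "chooser V r \<alpha>" "same_diag V r s" shows "\<alpha> (rename \<sigma> s) = \<sigma> (\<alpha> s)"
proof -
  have "wf_trm V (rename \<sigma> s)" using assms(2) by (simp add: same_diag_def)
  then show ?thesis using assms unfolding chooser_def by (blast intro: eq_conseq.refl)
qed

lemma chooser_eq:
  assumes "chooser V r \<alpha>" "same_diag V r s" "eq_conseq V s t" shows "\<alpha> t = \<alpha> s"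
proof -
  have "eq_conseq V (rename (\<lambda>x. x) s) t" using assms(3) by simp
  with assms(1,2) show ?thesis unfolding chooser_def by fast
qed

text \<open>
  A renaming that fixes the variables of \<open>t\<close> and moves all others fixes \<open>t\<close>, hence the chosen
  variable. In particular a diagonal containing a closed term has no chooser.
\<close>

lemma chooser_in_vars:
  assumes "chooser V r \<alpha>" "same_diag V r t" shows "\<alpha> t \<in> vars t"
proof -
  let ?\<sigma> = "\<lambda>x. if x \<in> vars t then x else Suc x"
  have "rename ?\<sigma> t = subst Var t" by (rule subst_cong) simp
  then have "\<alpha> t = ?\<sigma> (\<alpha> t)" using chooser_rename[OF assms, of ?\<sigma>] by simp
  then show ?thesis by (metis n_not_Suc_n)
qed

lemma chooser_cong_diag: "same_diag V r s \<Longrightarrow> chooser V r \<alpha> = chooser V s \<alpha>"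
  using same_diag_trans[of V r s] same_diag_trans[OF same_diag_sym, of V r s]
  unfolding chooser_def by (intro iffI allI impI) blast+

text \<open>
  The argument of \<open>t\<close> from which \<open>\<alpha>\<close> chooses when terms with the diagonals of \<open>\<rho> x\<close> are
  substituted for the variables: each \<open>\<rho> x\<close> is collapsed to the single variable \<open>x\<close>, so that the
  choice reveals the argument.
\<close>

definition chosen_arg :: "(('s, nat) trm \<Rightarrow> nat) \<Rightarrow> ('s, nat) trm \<Rightarrow> (nat \<Rightarrow> ('s, nat) trm) \<Rightarrow> nat" where
  "chosen_arg \<alpha> t \<rho> = \<alpha> (subst (\<lambda>x. rename (\<lambda>_. x) (\<rho> x)) t)"

text \<open>
  The chooser that \<open>\<alpha>\<close> induces on the terms \<open>s\<close> with the diagonal of the chosen argument: \<open>s\<close> is put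
  in this argument and all others are collapsed to the variable 0. By independence the choice of 0
  does not matter.
\<close>

definition derived :: "(('s, nat) trm \<Rightarrow> nat) \<Rightarrow> ('s, nat) trm \<Rightarrow> (nat \<Rightarrow> ('s, nat) trm)
    \<Rightarrow> ('s, nat) trm \<Rightarrow> nat" where
  "derived \<alpha> t \<rho> s =
    \<alpha> (subst ((\<lambda>x. rename (\<lambda>_. 0) (\<rho> x)) (chosen_arg \<alpha> t \<rho> := s)) t)"

lemma chosen_arg_cong:
  assumes "chooser V r \<alpha>" "wf_trm V t" "\<And>x. wf_trm V (\<rho> x)" "\<And>x. wf_trm V (\<rho>' x)"
    and "\<And>x. x \<in> vars t \<Longrightarrow> same_diag V (\<rho> x) (\<rho>' x)" and "same_diag V r (subst \<rho> t)"
  shows "chosen_arg \<alpha> t \<rho> = chosen_arg \<alpha> t \<rho>'"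
proof -
  have "same_diag V r (subst (\<lambda>x. rename (\<lambda>_. x) (\<rho> x)) t)"
    by (rule same_diag_trans[OF assms(6)], rule same_diag_subst)
      (simp_all add: assms(2,3) same_diag_rename)
  moreover have "eq_conseq V (subst (\<lambda>x. rename (\<lambda>_. x) (\<rho> x)) t) (subst (\<lambda>x. rename (\<lambda>_. x) (\<rho>' x)) t)"
    using assms by (intro eq_conseq_subst_cong same_diag_at)
  ultimately show ?thesis
    unfolding chosen_arg_def by (rule chooser_eq[OF assms(1), symmetric])
qed

lemma chosen_arg_in_vars:
  assumes "chooser V r \<alpha>" "wf_trm V t" "\<And>x. wf_trm V (\<rho> x)" "same_diag V r (subst \<rho> t)"
  shows "chosen_arg \<alpha> t \<rho> \<in> vars t"
proof -
  have "same_diag V r (subst (\<lambda>x. rename (\<lambda>_. x) (\<rho> x)) t)"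
    by (rule same_diag_trans[OF assms(4)], rule same_diag_subst)
      (simp_all add: assms(2,3) same_diag_rename)
  from chooser_in_vars[OF assms(1) this] show ?thesis
    by (auto simp: chosen_arg_def vars_subst)
qed

text \<open>
  The chosen variable depends only on the term in the chosen argument and on the diagonals of the
  others. The variables of different arguments are first made disjoint by encoding pairs. The choice
  from the resulting term \<open>apart \<rho>\<close> determines both the chosen argument (first component) and the
  variable chosen from \<open>subst \<rho> t\<close> (second component). The renaming \<open>\<kappa>\<close> collapses all arguments
  but the chosen one and fixes the choice; after it, \<open>\<rho>\<close> and \<open>\<rho>'\<close> give equal terms.
\<close>

lemma chooser_independent:
  assumes \<alpha>: "chooser V r \<alpha>" and t: "wf_trm V t"
    and \<rho>: "\<And>x. wf_trm V (\<rho> x)" and \<rho>': "\<And>x. wf_trm V (\<rho>' x)"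
    and diag: "\<And>x. x \<in> vars t \<Longrightarrow> same_diag V (\<rho> x) (\<rho>' x)" and r: "same_diag V r (subst \<rho> t)"
    and arg: "eq_conseq V (\<rho> (chosen_arg \<alpha> t \<rho>)) (\<rho>' (chosen_arg \<alpha> t \<rho>))"
  shows "\<alpha> (subst \<rho> t) = \<alpha> (subst \<rho>' t)"
proof -
  define i where "i = chosen_arg \<alpha> t \<rho>"
  define apart where "apart \<theta> = subst (\<lambda>x. rename (\<lambda>y. prod_encode (x, y)) (\<theta> x)) t" for \<theta> :: "nat \<Rightarrow> ('a, nat) trm"
  have rn: "rename \<delta> (apart \<theta>) = subst (\<lambda>x. rename (\<lambda>y. \<delta> (prod_encode (x, y))) (\<theta> x)) t" for \<delta> \<theta>
    by (simp add: apart_def subst_subst)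
  have r': "same_diag V r (subst \<rho>' t)"
    using same_diag_trans[OF r same_diag_subst[OF t \<rho> \<rho>' diag]] .
  have i': "i = chosen_arg \<alpha> t \<rho>'"
    unfolding i_def by (rule chosen_arg_cong[OF \<alpha> t \<rho> \<rho>' diag r])
  have apart: "same_diag V r (apart \<theta>)" "\<alpha> (subst \<theta> t) = snd (prod_decode (\<alpha> (apart \<theta>)))"
      "chosen_arg \<alpha> t \<theta> = fst (prod_decode (\<alpha> (apart \<theta>)))"
    if \<theta>: "\<And>x. wf_trm V (\<theta> x)" "same_diag V r (subst \<theta> t)" for \<theta>
  proof -
    show d: "same_diag V r (apart \<theta>)"
      unfolding apart_def
      by (rule same_diag_trans[OF that(2)], rule same_diag_subst)
        (simp_all add: t \<theta>(1) same_diag_rename)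
    show "\<alpha> (subst \<theta> t) = snd (prod_decode (\<alpha> (apart \<theta>)))"
      using chooser_rename[OF \<alpha> d, of "\<lambda>z. snd (prod_decode z)"] by (simp add: rn)
    show "chosen_arg \<alpha> t \<theta> = fst (prod_decode (\<alpha> (apart \<theta>)))"
      using chooser_rename[OF \<alpha> d, of "\<lambda>z. fst (prod_decode z)"] by (simp add: rn chosen_arg_def)
  qed
  define \<kappa> where "\<kappa> z = (case prod_decode z of (x, y) \<Rightarrow> prod_encode (x, if x = i then y else 0))" for z
  have \<kappa>: "\<kappa> z = z" if "fst (prod_decode z) = i" for z
    using that prod_decode_inverse[of z] by (cases "prod_decode z") (simp add: \<kappa>_def)
  have "eq_conseq V (rename \<kappa> (apart \<rho>)) (rename \<kappa> (apart \<rho>'))"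
    unfolding rn
  proof (rule eq_conseq_subst_cong[OF t])
    fix x assume x: "x \<in> vars t"
    show "eq_conseq V (rename (\<lambda>y. \<kappa> (prod_encode (x, y))) (\<rho> x)) (rename (\<lambda>y. \<kappa> (prod_encode (x, y))) (\<rho>' x))"
    proof (cases "x = i")
      case True
      then have "eq_conseq V (\<rho> x) (\<rho>' x)" using arg by (simp add: i_def)
      then show ?thesis by (rule eq_conseq_subst) simp
    next
      case False
      then show ?thesis using same_diag_at[OF diag[OF x]] by (simp add: \<kappa>_def)
    qed
  qed
  moreover have "same_diag V r (rename \<kappa> (apart \<rho>))"
    using apart(1)[OF \<rho> r]
    by (rule same_diag_trans)
      (rule same_diag_rename, use apart(1)[OF \<rho> r] in \<open>simp add: same_diag_def\<close>)
  ultimately have "\<alpha> (rename \<kappa> (apart \<rho>')) = \<alpha> (rename \<kappa> (apart \<rho>))"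
    by (intro chooser_eq[OF \<alpha>])
  then have "\<kappa> (\<alpha> (apart \<rho>')) = \<kappa> (\<alpha> (apart \<rho>))"
    using chooser_rename[OF \<alpha> apart(1)[OF \<rho> r]] chooser_rename[OF \<alpha> apart(1)[OF \<rho>' r']] by simp
  then have "\<alpha> (apart \<rho>') = \<alpha> (apart \<rho>)"
    using \<kappa>[OF apart(3)[OF \<rho> r, symmetric, folded i_def]]
      \<kappa>[OF apart(3)[OF \<rho>' r', symmetric, folded i']] by metis
  then show ?thesis using apart(2)[OF \<rho> r] apart(2)[OF \<rho>' r'] by simp
qed

text \<open>
  The restriction of a chooser to terms in the variables 0 and 1, encoded as the set of those terms
  from which 0 is chosen.
\<close>

definition profile :: "'s variety \<Rightarrow> ('s, nat) trm \<Rightarrow> (('s, nat) trm \<Rightarrow> nat) \<Rightarrow> ('s, nat) trm set" where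
  "profile V r \<alpha> = {s. same_diag V r s \<and> vars s \<subseteq> {0, 1} \<and> \<alpha> s = 0}"

definition profiles :: "'s variety \<Rightarrow> ('s, nat) trm \<Rightarrow> ('s, nat) trm set set" where
  "profiles V r = profile V r ` {\<alpha>. chooser V r \<alpha>}"

lemma same_diag_cong: "same_diag V r r' \<Longrightarrow> same_diag V r s \<longleftrightarrow> same_diag V r' s"
  using same_diag_trans same_diag_sym by blast

lemma profile_cong_diag: "same_diag V r r' \<Longrightarrow> profile V r = profile V r'"
  using same_diag_cong[of V r r'] by (simp add: profile_def fun_eq_iff)

lemma profiles_cong_diag: "same_diag V r r' \<Longrightarrow> profiles V r = profiles V r'"
  by (simp add: profiles_def profile_cong_diag chooser_cong_diag)

lemma profile_cong:
  "(\<And>s. same_diag V r s \<Longrightarrow> vars s \<subseteq> {0, 1} \<Longrightarrow> \<alpha> s = \<beta> s) \<Longrightarrow> profile V r \<alpha> = profile V r \<beta>"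
  by (auto simp: profile_def)

lemma profile_determines:
  assumes "chooser V r \<alpha>" "chooser V r \<beta>" "profile V r \<alpha> = profile V r \<beta>"
    and "same_diag V r s" "vars s \<subseteq> {0, 1}"
  shows "\<alpha> s = \<beta> s"
proof -
  have "\<alpha> s \<in> {0, 1}" "\<beta> s \<in> {0, 1}"
    using chooser_in_vars[OF assms(1,4)] chooser_in_vars[OF assms(2,4)] assms(5) by blast+
  moreover have "\<alpha> s = 0 \<longleftrightarrow> \<beta> s = 0"
    using assms(3-5) by (auto simp: profile_def)
  ultimately show ?thesis by auto
qed

lemma same_diag_spread:
  assumes "wf_trm V t" "\<And>x. wf_trm V (\<rho> x)" "same_diag V r (subst \<rho> t)"
  shows "same_diag V r (subst (\<lambda>x. rename (\<delta> x) (\<rho> x)) t)"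
  by (rule same_diag_trans[OF assms(3)], rule same_diag_subst)
    (simp_all add: assms(1,2) same_diag_rename)

lemma same_diag_derived:
  assumes "wf_trm V t" "\<And>x. wf_trm V (\<rho> x)" "same_diag V r (subst \<rho> t)" "same_diag V (\<rho> i) s"
  shows "same_diag V r (subst ((\<lambda>x. rename (\<lambda>_. y) (\<rho> x)) (i := s)) t)"
  by (rule same_diag_trans[OF assms(3)], rule same_diag_subst)
    (use assms(4) in \<open>auto simp: assms(1,2) same_diag_rename same_diag_def[of V "\<rho> i"]\<close>)

text \<open>
  Renaming the chosen argument to 0 and all other arguments to 1 gives a binary term from which 0 is
  chosen. A chooser with the same profile also chooses 0 there, which determines its argument.
\<close>

lemma chosen_arg_profile:
  assumes \<alpha>: "chooser V r \<alpha>" and \<beta>: "chooser V r \<beta>" and eq: "profile V r \<alpha> = profile V r \<beta>"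
    and t: "wf_trm V t" and \<rho>: "\<And>x. wf_trm V (\<rho> x)" and r: "same_diag V r (subst \<rho> t)"
  shows "chosen_arg \<alpha> t \<rho> = chosen_arg \<beta> t \<rho>"
proof -
  let ?s = "subst (\<lambda>x. rename (\<lambda>_. x) (\<rho> x)) t"
  let ?\<delta> = "\<lambda>x. if x = chosen_arg \<alpha> t \<rho> then 0 else 1 :: nat"
  have s: "same_diag V r ?s" by (rule same_diag_spread[OF t \<rho> r])
  have s': "same_diag V r (rename ?\<delta> ?s)"
    by (rule same_diag_trans[OF s same_diag_rename]) (use s in \<open>simp add: same_diag_def\<close>)
  have v: "vars (rename ?\<delta> ?s) \<subseteq> {0, 1}" by (auto simp: vars_subst split: if_splits)
  have "?\<delta> (\<beta> ?s) = ?\<delta> (\<alpha> ?s)"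
    using profile_determines[OF \<alpha> \<beta> eq s' v] chooser_rename[OF \<alpha> s] chooser_rename[OF \<beta> s] by simp
  then show ?thesis by (simp add: chosen_arg_def split: if_splits)
qed

text \<open>
  The derived chooser is evaluated at binary terms by collapsing the other arguments to 0, which
  yields binary terms again.
\<close>

lemma derived_profile:
  assumes \<alpha>: "chooser V r \<alpha>" and \<beta>: "chooser V r \<beta>" and eq: "profile V r \<alpha> = profile V r \<beta>"
    and t: "wf_trm V t" and \<rho>: "\<And>x. wf_trm V (\<rho> x)" and r: "same_diag V r (subst \<rho> t)"
  shows "profile V (\<rho> (chosen_arg \<alpha> t \<rho>)) (derived \<alpha> t \<rho>)
    = profile V (\<rho> (chosen_arg \<beta> t \<rho>)) (derived \<beta> t \<rho>)"
proof -
  have i: "chosen_arg \<beta> t \<rho> = chosen_arg \<alpha> t \<rho>"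
    using chosen_arg_profile[OF \<alpha> \<beta> eq t \<rho> r] by simp
  have "derived \<alpha> t \<rho> s = derived \<beta> t \<rho> s"
    if "same_diag V (\<rho> (chosen_arg \<alpha> t \<rho>)) s" "vars s \<subseteq> {0, 1}" for s
    unfolding derived_def i
  proof (rule profile_determines[OF \<alpha> \<beta> eq same_diag_derived[OF t \<rho> r that(1)]])
    show "vars (subst ((\<lambda>x. rename (\<lambda>_. 0) (\<rho> x)) (chosen_arg \<alpha> t \<rho> := s)) t) \<subseteq> {0, 1}"
      using that(2) by (auto simp: vars_subst split: if_splits)
  qed
  then show ?thesis unfolding i by (intro profile_cong)
qed

lemma chosen_arg_unchanged:
  assumes \<alpha>: "chooser V r \<alpha>" and t: "wf_trm V t" and \<rho>: "\<And>x. wf_trm V (\<rho> x)"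
    and r: "same_diag V r (subst \<rho> t)" and s: "same_diag V (\<rho> i) s"
  shows "chosen_arg \<alpha> t ((\<lambda>x. rename (\<lambda>_. y) (\<rho> x)) (i := s)) = chosen_arg \<alpha> t \<rho>"
  by (rule chosen_arg_cong[OF \<alpha> t \<rho> _ _ r, symmetric])
    (use s \<rho> in \<open>auto simp: same_diag_rename same_diag_def[of V "\<rho> i"]\<close>)

text \<open>
  Renaming \<open>s\<close> by \<open>\<sigma>\<close> in the chosen argument also renames the variable 0 in all others to \<open>\<sigma> 0\<close>.
  Independence moves it back to 0.
\<close>

lemma chooser_derived:
  assumes \<alpha>: "chooser V r \<alpha>" and t: "wf_trm V t" and \<rho>: "\<And>x. wf_trm V (\<rho> x)"
    and r: "same_diag V r (subst \<rho> t)" and V: "wf_variety V"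
  shows "chooser V (\<rho> (chosen_arg \<alpha> t \<rho>)) (derived \<alpha> t \<rho>)"
  unfolding chooser_def
proof (intro allI impI, elim conjE)
  fix s s' \<sigma>
  let ?i = "chosen_arg \<alpha> t \<rho>"
  assume s: "same_diag V (\<rho> ?i) s" and s': "eq_conseq V (rename \<sigma> s) s'"
  have ws: "wf_trm V s" using s by (simp add: same_diag_def)
  have ws': "wf_trm V s'" using eq_conseq_wf[OF V s'] ..
  have sr: "same_diag V (\<rho> ?i) (rename \<sigma> s)"
    by (rule same_diag_trans[OF s same_diag_rename[OF ws]])
  let ?\<theta> = "(\<lambda>x. rename (\<lambda>_. 0) (\<rho> x)) (?i := s)"
  let ?\<eta> = "(\<lambda>x. rename (\<lambda>_. \<sigma> 0) (\<rho> x)) (?i := rename \<sigma> s)"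
  let ?\<eta>' = "(\<lambda>x. rename (\<lambda>_. 0) (\<rho> x)) (?i := s')"
  have eta: "rename \<sigma> (subst ?\<theta> t) = subst ?\<eta> t"
    unfolding subst_subst by (rule subst_cong) (simp add: subst_subst)
  have "\<alpha> (subst ?\<eta> t) = \<alpha> (subst ?\<eta>' t)"
  proof (rule chooser_independent[OF \<alpha> t])
    show "wf_trm V (?\<eta> x)" "wf_trm V (?\<eta>' x)" for x using \<rho> ws ws' by simp_all
    show "same_diag V r (subst ?\<eta> t)" by (rule same_diag_derived[OF t \<rho> r sr])
    show "same_diag V (?\<eta> x) (?\<eta>' x)" for x
      using eq_conseq_same_diag[OF V s'] \<rho>
      by (simp add: same_diag_trans[OF same_diag_sym[OF same_diag_rename] same_diag_rename])
    have "chosen_arg \<alpha> t ?\<eta> = ?i" by (rule chosen_arg_unchanged[OF \<alpha> t \<rho> r sr])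
    then show "eq_conseq V (?\<eta> (chosen_arg \<alpha> t ?\<eta>)) (?\<eta>' (chosen_arg \<alpha> t ?\<eta>))" using s' by simp
  qed
  moreover have "\<alpha> (rename \<sigma> (subst ?\<theta> t)) = \<sigma> (\<alpha> (subst ?\<theta> t))"
    by (rule chooser_rename[OF \<alpha> same_diag_derived[OF t \<rho> r s]])
  ultimately show "derived \<alpha> t \<rho> s' = \<sigma> (derived \<alpha> t \<rho> s)"
    by (simp add: derived_def eta)
qed

text \<open>
  By independence, the collapsed arguments in the definition of the derived chooser may be replaced
  by any terms with the same diagonals.
\<close>

lemma derived_eq:
  assumes \<alpha>: "chooser V r \<alpha>" and t: "wf_trm V t" and \<tau>: "\<And>x. wf_trm V (\<tau> x)"
    and \<theta>: "\<And>x. wf_trm V (\<theta> x)"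
    and diag: "\<And>x. x \<in> vars t \<Longrightarrow> same_diag V (\<tau> x) (\<theta> x)"
    and r: "same_diag V r (subst \<tau> t)"
  shows "derived \<alpha> t \<tau> (\<theta> (chosen_arg \<alpha> t \<tau>)) = \<alpha> (subst \<theta> t)"
proof -
  let ?i = "chosen_arg \<alpha> t \<tau>"
  have i: "?i \<in> vars t" by (rule chosen_arg_in_vars[OF \<alpha> t \<tau> r])
  let ?\<eta> = "(\<lambda>x. rename (\<lambda>_. 0) (\<tau> x)) (?i := \<theta> ?i)"
  have "\<alpha> (subst ?\<eta> t) = \<alpha> (subst \<theta> t)"
  proof (rule chooser_independent[OF \<alpha> t])
    show "wf_trm V (?\<eta> x)" "wf_trm V (\<theta> x)" for x using \<tau> \<theta> by simp_all
    show "same_diag V r (subst ?\<eta> t)" by (rule same_diag_derived[OF t \<tau> r diag[OF i]])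
    show "same_diag V (?\<eta> x) (\<theta> x)" if "x \<in> vars t" for x
      using same_diag_trans[OF same_diag_sym[OF same_diag_rename[OF \<tau>]] diag[OF that]]
      by (simp add: same_diag_refl \<theta>)
    have "chosen_arg \<alpha> t ?\<eta> = ?i" by (rule chosen_arg_unchanged[OF \<alpha> t \<tau> r diag[OF i]])
    then show "eq_conseq V (?\<eta> (chosen_arg \<alpha> t ?\<eta>)) (\<theta> (chosen_arg \<alpha> t ?\<eta>))"
      using \<theta> by (simp add: eq_conseq.refl)
  qed
  then show ?thesis by (simp add: derived_def)
qed

text \<open>
  Choosing from a composed term \<open>subst \<tau> t\<close> means choosing an argument of \<open>t\<close> first and then
  choosing, by the derived chooser, from the term substituted there. This makes the operations
  defined below compose like terms. The terms \<open>\<theta> x\<close> are arbitrary representatives of the diagonals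
  of the substituted terms.
\<close>

lemma chosen_arg_subst:
  assumes \<alpha>: "chooser V r \<alpha>" and t: "wf_trm V t" and \<tau>: "\<And>x. wf_trm V (\<tau> x)"
    and \<rho>: "\<And>x. wf_trm V (\<rho> x)" and \<theta>: "\<And>x. wf_trm V (\<theta> x)"
    and \<theta>_diag: "\<And>x. x \<in> vars t \<Longrightarrow> same_diag V (\<theta> x) (subst \<rho> (\<tau> x))"
    and r: "same_diag V r (subst \<theta> t)" and V: "wf_variety V"
  defines "i \<equiv> chosen_arg \<alpha> t \<theta>"
  shows "chosen_arg (derived \<alpha> t \<theta>) (\<tau> i) \<rho> = chosen_arg \<alpha> (subst \<tau> t) \<rho>" (is ?arg)
    and "same_diag V (\<rho> (chosen_arg \<alpha> (subst \<tau> t) \<rho>)) s \<Longrightarrow>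
      derived (derived \<alpha> t \<theta>) (\<tau> i) \<rho> s = derived \<alpha> (subst \<tau> t) \<rho> s"
proof -
  have \<theta>': "same_diag V (\<theta> x) (subst (\<lambda>y. rename (\<delta> y) (\<rho> y)) (\<tau> x))" if "x \<in> vars t" for x \<delta>
    by (rule same_diag_spread[OF \<tau> \<rho> \<theta>_diag[OF that]])
  have eq: "derived \<alpha> t \<theta> (subst \<eta> (\<tau> i)) = \<alpha> (subst \<eta> (subst \<tau> t))"
    if "\<And>x. wf_trm V (\<eta> x)" "\<And>x. x \<in> vars t \<Longrightarrow> same_diag V (\<theta> x) (subst \<eta> (\<tau> x))" for \<eta>
    unfolding i_def subst_subst
    by (rule derived_eq[OF \<alpha> t \<theta> _ _ r]) (simp_all add: that wf_subst[OF \<tau>])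
  show arg: ?arg
    unfolding chosen_arg_def by (rule eq) (simp_all add: \<rho> \<theta>')
  assume s: "same_diag V (\<rho> (chosen_arg \<alpha> (subst \<tau> t) \<rho>)) s"
  then have ws: "wf_trm V s" by (simp add: same_diag_def)
  show "derived (derived \<alpha> t \<theta>) (\<tau> i) \<rho> s = derived \<alpha> (subst \<tau> t) \<rho> s"
    unfolding derived_def[of "derived \<alpha> t \<theta>"] arg derived_def[of \<alpha> "subst \<tau> t"]
    by (rule eq) (use ws in \<open>simp_all add: \<rho> same_diag_derived[OF \<tau> \<rho> \<theta>_diag s]\<close>)
qed

section \<open>The algebra on a disjoint union of powers\<close>

text \<open>
  Vertices name a diagonal by its class of terms, whereas choosers refer to terms; \<open>rep\<close> returns to
  some member of the class, which need not be unary.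
\<close>

definition rep :: "('s, nat) trm set \<Rightarrow> ('s, nat) trm" where
  "rep c = (SOME t. t \<in> c)"

definition diagonals :: "'s variety \<Rightarrow> ('s, nat) trm set set" where
  "diagonals V = (\<lambda>t. term_class V (rename (\<lambda>_. 0) t)) ` {t. wf_trm V t}"

text \<open>
  The first component of the value is the diagonal of \<open>f\<close> applied to the diagonals of the arguments.
  The coordinate indexed by the profile of a chooser \<open>\<alpha>\<close> is copied from the chosen argument, at the
  profile of the derived chooser. Any chooser with the given profile may be taken.
\<close>

definition power_op ::
  "'s variety \<Rightarrow> 's \<Rightarrow> (('s, nat) trm set \<times> (('s, nat) trm set \<Rightarrow> 'x)) list
    \<Rightarrow> ('s, nat) trm set \<times> (('s, nat) trm set \<Rightarrow> 'x)" where
  "power_op V f xs =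
    (let t = Op f (map Var [0..<length xs]);
         \<rho> = (\<lambda>i. if i < length xs then rep (fst (xs ! i)) else Var 0);
         c = term_class V (rename (\<lambda>_. 0) (subst \<rho> t))
     in (c, \<lambda>S\<in>profiles V (rep c).
          let \<alpha> = (SOME \<alpha>. chooser V (rep c) \<alpha> \<and> profile V (rep c) \<alpha> = S); i = chosen_arg \<alpha> t \<rho>
          in snd (xs ! i) (profile V (\<rho> i) (derived \<alpha> t \<rho>))))"

lemma term_class_cong:
  "same_diag V s t \<Longrightarrow> term_class V (rename (\<lambda>_. 0) s) = term_class V (rename (\<lambda>_. 0) t)"
  by (subst term_class_eq_iff) (simp_all only: same_diag_def wf_rename)

context
  fixes V :: "'s variety"
  assumes V: "wf_variety V"
begin

lemma rep_term_class:
  assumes "wf_trm V t"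
  shows "same_diag V t (rep (term_class V (rename (\<lambda>_. 0) t)))"
    "term_class V (rename (\<lambda>_. 0) t) \<in> diagonals V"
proof -
  let ?c = "term_class V (rename (\<lambda>_. 0) t)"
  have "rename (\<lambda>_. 0) t \<in> ?c"
    using assms by (simp add: term_class_def eq_conseq.refl)
  then have "rep ?c \<in> ?c" unfolding rep_def by (rule someI)
  then have "same_diag V (rename (\<lambda>_. 0) t) (rep ?c)"
    by (intro eq_conseq_same_diag[OF V]) (simp add: term_class_def)
  then show "same_diag V t (rep ?c)"
    by (rule same_diag_trans[OF same_diag_rename[OF assms]])
  show "?c \<in> diagonals V" using assms by (auto simp: diagonals_def)
qed

lemma rep_diagonal:
  assumes "c \<in> diagonals V"
  shows "wf_trm V (rep c)" "term_class V (rename (\<lambda>_. 0) (rep c)) = c"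
proof -
  obtain t where t: "wf_trm V t" "c = term_class V (rename (\<lambda>_. 0) t)"
    using assms by (auto simp: diagonals_def)
  then have "same_diag V t (rep c)" using rep_term_class(1) by simp
  then show "wf_trm V (rep c)" "term_class V (rename (\<lambda>_. 0) (rep c)) = c"
    using same_diag_sym[of V t "rep c"] by (simp_all add: same_diag_def t(2) term_class_eq_iff)
qed

text \<open>
  The computation rule for \<open>power_op\<close>, for an arbitrary term \<open>r\<close> with the diagonal of the value and
  an arbitrary chooser with the given profile in place of the selected ones.
\<close>

lemma power_op_apply:
  fixes xs :: "(('s, nat) trm set \<times> (('s, nat) trm set \<Rightarrow> 'x)) list"
  assumes f: "f \<in> opsyms V" "length xs = arity V f" and xs: "fst ` set xs \<subseteq> diagonals V"
    and t_def: "t = Op f (map Var [0..<length xs])"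
    and \<rho>_def: "\<rho> = (\<lambda>i. if i < length xs then rep (fst (xs ! i)) else Var 0)"
  shows "wf_trm V t" "wf_trm V (\<rho> i)"
    and "fst (power_op V f xs) = term_class V (rename (\<lambda>_. 0) (subst \<rho> t))"
    and "snd (power_op V f xs) \<in> extensional (profiles V (rep (fst (power_op V f xs))))"
    and "same_diag V r (subst \<rho> t) \<Longrightarrow> chooser V r \<alpha> \<Longrightarrow> chosen_arg \<alpha> t \<rho> < length xs"
    and "same_diag V r (subst \<rho> t) \<Longrightarrow> chooser V r \<alpha> \<Longrightarrow> snd (power_op V f xs) (profile V r \<alpha>)
      = snd (xs ! chosen_arg \<alpha> t \<rho>) (profile V (\<rho> (chosen_arg \<alpha> t \<rho>)) (derived \<alpha> t \<rho>))"
proof -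
  show t: "wf_trm V t" using f by (simp add: t_def list_all_iff)
  show \<rho>: "wf_trm V (\<rho> i)" for i
    using rep_diagonal(1)[of "fst (xs ! i)"] xs by (simp add: \<rho>_def image_subset_iff)
  let ?c = "term_class V (rename (\<lambda>_. 0) (subst \<rho> t))"
  have c: "fst (power_op V f xs) = ?c"
    by (simp add: power_op_def Let_def t_def \<rho>_def)
  then show "fst (power_op V f xs) = ?c" .
  have s: "snd (power_op V f xs) = (\<lambda>S\<in>profiles V (rep ?c).
      let \<alpha> = (SOME \<alpha>. chooser V (rep ?c) \<alpha> \<and> profile V (rep ?c) \<alpha> = S); i = chosen_arg \<alpha> t \<rho>
      in snd (xs ! i) (profile V (\<rho> i) (derived \<alpha> t \<rho>)))"
    unfolding power_op_def Let_def t_def \<rho>_def by simp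
  show "snd (power_op V f xs) \<in> extensional (profiles V (rep (fst (power_op V f xs))))"
    unfolding c s by (rule restrict_extensional)
  assume r: "same_diag V r (subst \<rho> t)" and \<alpha>: "chooser V r \<alpha>"
  have "chosen_arg \<alpha> t \<rho> \<in> vars t" by (rule chosen_arg_in_vars[OF \<alpha> t \<rho> r])
  then show "chosen_arg \<alpha> t \<rho> < length xs" by (auto simp: t_def)
  have rc: "same_diag V r (rep ?c)"
    by (rule same_diag_trans[OF r rep_term_class(1)[OF wf_subst[OF t \<rho>]]])
  define \<beta> where "\<beta> = (SOME \<beta>. chooser V (rep ?c) \<beta> \<and> profile V (rep ?c) \<beta> = profile V r \<alpha>)"
  have "chooser V (rep ?c) \<alpha> \<and> profile V (rep ?c) \<alpha> = profile V r \<alpha>"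
    using \<alpha> chooser_cong_diag[OF rc] profile_cong_diag[OF rc] by simp
  from someI[of "\<lambda>\<beta>. chooser V (rep ?c) \<beta> \<and> profile V (rep ?c) \<beta> = profile V r \<alpha>", OF this]
  have \<beta>: "chooser V r \<beta>" "profile V r \<alpha> = profile V r \<beta>"
    using chooser_cong_diag[OF rc] profile_cong_diag[OF rc] unfolding \<beta>_def by simp_all
  have "profile V r \<alpha> \<in> profiles V (rep ?c)"
    unfolding profiles_cong_diag[OF rc, symmetric] using \<alpha> by (simp add: profiles_def)
  then have "snd (power_op V f xs) (profile V r \<alpha>)
      = snd (xs ! chosen_arg \<beta> t \<rho>) (profile V (\<rho> (chosen_arg \<beta> t \<rho>)) (derived \<beta> t \<rho>))"
    by (simp add: s Let_def \<beta>_def)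
  then show "snd (power_op V f xs) (profile V r \<alpha>)
      = snd (xs ! chosen_arg \<alpha> t \<rho>) (profile V (\<rho> (chosen_arg \<alpha> t \<rho>)) (derived \<alpha> t \<rho>))"
    using chosen_arg_profile[OF \<alpha> \<beta> t \<rho> r] derived_profile[OF \<alpha> \<beta> t \<rho> r] by simp
qed

text \<open>
  Every term acts by the same rule as the operation symbols: it copies the coordinate selected by the
  chosen argument and the derived chooser. The induction step is the composition law
  \<open>chosen_arg_subst\<close>.
\<close>

lemma eval_power_op:
  fixes e :: "nat \<Rightarrow> ('s, nat) trm set \<times> (('s, nat) trm set \<Rightarrow> 'x)"
  assumes e': "\<forall>x. fst (e x) \<in> diagonals V \<and> snd (e x) \<in> extensional (profiles V (rep (fst (e x))))"
    and \<rho>_def: "\<rho> = (\<lambda>x. rep (fst (e x)))"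
    and "wf_trm V t"
  shows "fst (eval (power_op V) e t) = term_class V (rename (\<lambda>_. 0) (subst \<rho> t)) \<and>
    snd (eval (power_op V) e t) \<in> extensional (profiles V (subst \<rho> t)) \<and>
    (\<forall>\<alpha>. chooser V (subst \<rho> t) \<alpha> \<longrightarrow>
      snd (eval (power_op V) e t) (profile V (subst \<rho> t) \<alpha>) =
        snd (e (chosen_arg \<alpha> t \<rho>)) (profile V (\<rho> (chosen_arg \<alpha> t \<rho>)) (derived \<alpha> t \<rho>)))"
  using assms(3)
proof (induction t)
  case (Var x)
  note e = e'[rule_format, THEN conjunct1] e'[rule_format, THEN conjunct2]
  have \<rho>: "wf_trm V (\<rho> y)" for y using rep_diagonal(1)[OF e(1)] by (simp add: \<rho>_def)
  have "chosen_arg \<alpha> (Var x) \<rho> = x" if \<alpha>: "chooser V (\<rho> x) \<alpha>" for \<alpha>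
    using chosen_arg_in_vars[OF \<alpha>, of "Var x" \<rho>] \<rho> same_diag_refl[OF \<rho>] by simp
  then show ?case
    using e rep_diagonal(2)[OF e(1)] by (simp add: \<rho>_def derived_def)
next
  case (Op f ts)
  note e = e'[rule_format, THEN conjunct1]
  have \<rho>: "wf_trm V (\<rho> y)" for y using rep_diagonal(1)[OF e] by (simp add: \<rho>_def)
  have f: "f \<in> opsyms V" and len: "length ts = arity V f" and wts: "\<And>s. s \<in> set ts \<Longrightarrow> wf_trm V s"
    using Op.prems by (auto simp: list_all_iff)
  let ?xs = "map (eval (power_op V) e) ts"
  let ?n = "length ts"
  let ?t = "Op f (map Var [0..<length ?xs])"
  let ?\<theta> = "\<lambda>i. if i < length ?xs then rep (fst (?xs ! i)) else Var 0"
  let ?\<tau> = "\<lambda>i. if i < ?n then ts ! i else Var 0"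
  let ?r = "subst \<rho> (Op f ts)"
  have \<tau>: "wf_trm V (?\<tau> i)" for i using wts by simp
  have sub: "subst ?\<tau> ?t = Op f ts"
    by (simp, rule nth_equalityI) simp_all
  have IH: "fst (?xs ! i) = term_class V (rename (\<lambda>_. 0) (subst \<rho> (ts ! i)))"
      "\<And>\<alpha>. chooser V (subst \<rho> (ts ! i)) \<alpha> \<Longrightarrow> snd (?xs ! i) (profile V (subst \<rho> (ts ! i)) \<alpha>) =
        snd (e (chosen_arg \<alpha> (ts ! i) \<rho>))
          (profile V (\<rho> (chosen_arg \<alpha> (ts ! i) \<rho>)) (derived \<alpha> (ts ! i) \<rho>))"
    if "i < ?n" for i
    unfolding nth_map[OF that]
    using Op.IH[OF nth_mem[OF that] wts[OF nth_mem[OF that]]] by (blast, blast)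
  have "fst (?xs ! i) \<in> diagonals V" if "i < ?n" for i
    unfolding IH(1)[OF that] by (rule rep_term_class(2)[OF wf_subst[OF wts[OF nth_mem[OF that]] \<rho>]])
  then have xs: "fst ` set ?xs \<subseteq> diagonals V"
    by (simp add: image_subset_iff all_set_conv_all_nth)
  have len': "length ?xs = arity V f" using len by simp
  note op = power_op_apply[OF f len' xs HOL.refl HOL.refl]
  have \<theta>_diag: "same_diag V (?\<theta> i) (subst \<rho> (?\<tau> i))" if "i \<in> vars ?t" for i
  proof -
    have i: "i < ?n" using that by auto
    show ?thesis
      using same_diag_sym[OF rep_term_class(1)[OF wf_subst[OF wts[OF nth_mem[OF i]] \<rho>]]] i IH(1)[OF i]
      by simp
  qed
  have r: "same_diag V ?r (subst ?\<theta> ?t)"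
    unfolding sub[symmetric] subst_subst[of \<rho>]
    by (rule same_diag_sym, rule same_diag_subst[OF op(1,2) wf_subst[OF \<tau> \<rho>] \<theta>_diag])
  have fst: "fst (power_op V f ?xs) = term_class V (rename (\<lambda>_. 0) ?r)"
    unfolding op(3) by (rule term_class_cong[OF same_diag_sym[OF r]])
  have "same_diag V ?r (rep (fst (power_op V f ?xs)))"
    unfolding fst using r by (intro rep_term_class) (simp only: same_diag_def)
  then have ext: "snd (power_op V f ?xs) \<in> extensional (profiles V ?r)"
    using op(4) profiles_cong_diag[of V ?r "rep (fst (power_op V f ?xs))"] by simp
  have "snd (power_op V f ?xs) (profile V ?r \<alpha>) =
      snd (e (chosen_arg \<alpha> (Op f ts) \<rho>)) (profile V (\<rho> (chosen_arg \<alpha> (Op f ts) \<rho>)) (derived \<alpha> (Op f ts) \<rho>))"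
    if \<alpha>: "chooser V ?r \<alpha>" for \<alpha>
  proof -
    define i where "i = chosen_arg \<alpha> ?t ?\<theta>"
    have i: "i < ?n" using op(5)[OF r \<alpha>] by (simp add: i_def)
    have iv: "i \<in> vars ?t" using i by auto
    let ?\<beta> = "derived \<alpha> ?t ?\<theta>"
    have d: "same_diag V (?\<theta> i) (subst \<rho> (ts ! i))" using \<theta>_diag[OF iv] i by simp
    have \<beta>: "chooser V (subst \<rho> (ts ! i)) ?\<beta>"
      using chooser_derived[OF \<alpha> op(1,2) r V] unfolding i_def[symmetric] chooser_cong_diag[OF d] .
    have arg: "chosen_arg ?\<beta> (ts ! i) \<rho> = chosen_arg \<alpha> (Op f ts) \<rho>"
      using chosen_arg_subst(1)[OF \<alpha> op(1) \<tau> \<rho> op(2) \<theta>_diag r V] i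
      unfolding i_def[symmetric] sub by simp
    have der: "derived ?\<beta> (ts ! i) \<rho> s = derived \<alpha> (Op f ts) \<rho> s"
      if "same_diag V (\<rho> (chosen_arg \<alpha> (Op f ts) \<rho>)) s" for s
      using chosen_arg_subst(2)[OF \<alpha> op(1) \<tau> \<rho> op(2) \<theta>_diag r V, of s] that i
      unfolding i_def[symmetric] sub by simp
    have "snd (power_op V f ?xs) (profile V ?r \<alpha>) = snd (?xs ! i) (profile V (?\<theta> i) ?\<beta>)"
      using op(6)[OF r \<alpha>] unfolding i_def[symmetric] .
    also have "\<dots> = snd (?xs ! i) (profile V (subst \<rho> (ts ! i)) ?\<beta>)"
      unfolding profile_cong_diag[OF d] ..
    also have "\<dots> = snd (e (chosen_arg \<alpha> (Op f ts) \<rho>))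
        (profile V (\<rho> (chosen_arg \<alpha> (Op f ts) \<rho>)) (derived ?\<beta> (ts ! i) \<rho>))"
      unfolding IH(2)[OF i \<beta>] arg ..
    also have "profile V (\<rho> (chosen_arg \<alpha> (Op f ts) \<rho>)) (derived ?\<beta> (ts ! i) \<rho>)
        = profile V (\<rho> (chosen_arg \<alpha> (Op f ts) \<rho>)) (derived \<alpha> (Op f ts) \<rho>)"
      by (rule profile_cong) (rule der)
    finally show ?thesis .
  qed
  with fst ext show ?case unfolding eval.simps by (intro conjI allI impI)
qed

end

lemma in_Sigma_iff: "x \<in> Sigma A B \<longleftrightarrow> fst x \<in> A \<and> snd x \<in> B (fst x)"
  by (cases x) simp

context
  fixes V :: "'s variety"
  assumes V: "wf_variety V"
begin

text \<open>
  Which coordinate of which argument is copied depends only on the components of the arguments. So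
  the operation preserves every relation that is defined coordinatewise within components.
\<close>

lemma power_op_coordinate:
  fixes xs :: "(('s, nat) trm set \<times> (('s, nat) trm set \<Rightarrow> 'x)) list"
  assumes f: "f \<in> opsyms V" and len: "length xs = arity V f" and xs: "fst ` set xs \<subseteq> diagonals V"
    and S: "S \<in> profiles V (rep (fst (power_op V f xs)))"
  shows "\<exists>i<length xs. \<exists>S'\<in>profiles V (rep (fst (xs ! i))).
    \<forall>ys :: (('s, nat) trm set \<times> (('s, nat) trm set \<Rightarrow> 'x)) list.
      map fst ys = map fst xs \<longrightarrow> snd (power_op V f ys) S = snd (ys ! i) S'"
proof -
  define t where "t = (Op f (map Var [0..<length xs]) :: ('s, nat) trm)"
  define \<rho> where "\<rho> = (\<lambda>i. if i < length xs then rep (fst (xs ! i)) else Var 0)"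
  note op = power_op_apply[OF V f len xs t_def \<rho>_def]
  let ?r = "rep (fst (power_op V f xs))"
  obtain \<alpha> where \<alpha>: "chooser V ?r \<alpha>" and S_eq: "S = profile V ?r \<alpha>"
    using S by (auto simp: profiles_def)
  have r: "same_diag V ?r (subst \<rho> t)"
    unfolding op(3) by (rule same_diag_sym, rule rep_term_class(1)[OF V wf_subst[OF op(1) op(2)]])
  let ?i = "chosen_arg \<alpha> t \<rho>"
  have i: "?i < length xs" by (rule op(5)[OF r \<alpha>])
  show ?thesis
  proof (intro exI conjI bexI allI impI)
    show "?i < length xs" by (rule i)
    show "profile V (\<rho> ?i) (derived \<alpha> t \<rho>) \<in> profiles V (rep (fst (xs ! ?i)))"
      using chooser_derived[OF \<alpha> op(1,2) r V] i by (simp add: profiles_def \<rho>_def)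
    fix ys :: "(('s, nat) trm set \<times> (('s, nat) trm set \<Rightarrow> 'x)) list"
    assume fst: "map fst ys = map fst xs"
    then have len': "length ys = length xs" by (metis length_map)
    have nth: "fst (ys ! i) = fst (xs ! i)" if "i < length xs" for i
      using that fst len' by (metis nth_map)
    have ys: "fst ` set ys \<subseteq> diagonals V" using xs fst by (metis set_map)
    have t': "t = Op f (map Var [0..<length ys])" by (simp add: t_def len')
    have \<rho>': "\<rho> = (\<lambda>i. if i < length ys then rep (fst (ys ! i)) else Var 0)"
      by (simp add: \<rho>_def len' nth fun_eq_iff)
    have len'': "length ys = arity V f" using len len' by simp
    note op' = power_op_apply[OF V f len'' ys t' \<rho>']
    show "snd (power_op V f ys) S = snd (ys ! ?i) (profile V (\<rho> ?i) (derived \<alpha> t \<rho>))"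
      unfolding S_eq by (rule op'(6)[OF r \<alpha>])
  qed
qed

lemma fst_power_op:
  assumes "map fst ys = map fst xs"
  shows "fst (power_op V f ys) = fst (power_op V f xs)"
proof -
  have len: "length ys = length xs" using assms by (metis length_map)
  have nth: "fst (ys ! i) = fst (xs ! i)" if "i < length xs" for i
    using that assms len by (metis nth_map)
  show ?thesis by (simp add: power_op_def Let_def len nth cong: if_cong)
qed

text \<open>
  The rule in \<open>eval_power_op\<close> refers to a term only through values of choosers at substitution
  instances of it, and choosers respect the identities.
\<close>

lemma eval_power_op_ident:
  fixes e :: "nat \<Rightarrow> ('s, nat) trm set \<times> (('s, nat) trm set \<Rightarrow> 'x)"
  assumes e: "\<forall>x. fst (e x) \<in> diagonals V \<and> snd (e x) \<in> extensional (profiles V (rep (fst (e x))))"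
    and st: "(s, t) \<in> idents V"
  shows "eval (power_op V) e s = eval (power_op V) e t"
proof -
  define \<rho> where "\<rho> = (\<lambda>x. rep (fst (e x)))"
  have \<rho>: "wf_trm V (\<rho> x)" for x using rep_diagonal(1)[OF V] e by (simp add: \<rho>_def)
  have ws: "wf_trm V s" and wt: "wf_trm V t" using V st by (auto simp: wf_variety_def)
  have id: "eq_conseq V (subst \<sigma> s) (subst \<sigma> t)" if "\<And>x. wf_trm V (\<sigma> x)" for \<sigma>
    using st that by (rule eq_conseq.ident)
  have d: "same_diag V (subst \<rho> s) (subst \<rho> t)"
    by (rule eq_conseq_same_diag[OF V id[OF \<rho>]])
  note es = eval_power_op[OF V e \<rho>_def ws] and et = eval_power_op[OF V e \<rho>_def wt]
  have "snd (eval (power_op V) e s) = snd (eval (power_op V) e t)"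
  proof (rule extensionalityI)
    show "snd (eval (power_op V) e s) \<in> extensional (profiles V (subst \<rho> s))" using es by blast
    show "snd (eval (power_op V) e t) \<in> extensional (profiles V (subst \<rho> s))"
      unfolding profiles_cong_diag[OF d] using et by blast
    fix S assume "S \<in> profiles V (subst \<rho> s)"
    then obtain \<alpha> where \<alpha>: "chooser V (subst \<rho> s) \<alpha>" and S: "S = profile V (subst \<rho> s) \<alpha>"
      by (auto simp: profiles_def)
    have \<alpha>': "chooser V (subst \<rho> t) \<alpha>" using \<alpha> chooser_cong_diag[OF d] by simp
    have r: "same_diag V (subst \<rho> s) (subst \<rho> s)" by (rule same_diag_refl[OF wf_subst[OF ws \<rho>]])
    have arg: "chosen_arg \<alpha> t \<rho> = chosen_arg \<alpha> s \<rho>"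
      unfolding chosen_arg_def
      by (rule chooser_eq[OF \<alpha> same_diag_spread[OF ws \<rho> r] id]) (simp add: \<rho>)
    have "derived \<alpha> s \<rho> u = derived \<alpha> t \<rho> u" if u: "same_diag V (\<rho> (chosen_arg \<alpha> s \<rho>)) u" for u
      unfolding derived_def arg
      by (rule chooser_eq[OF \<alpha> same_diag_derived[OF ws \<rho> r u] id, symmetric])
        (use u \<rho> in \<open>simp add: same_diag_def\<close>)
    then have der: "profile V (\<rho> (chosen_arg \<alpha> s \<rho>)) (derived \<alpha> s \<rho>)
        = profile V (\<rho> (chosen_arg \<alpha> s \<rho>)) (derived \<alpha> t \<rho>)"
      by (intro profile_cong)
    have "snd (eval (power_op V) e s) S
        = snd (e (chosen_arg \<alpha> s \<rho>)) (profile V (\<rho> (chosen_arg \<alpha> s \<rho>)) (derived \<alpha> s \<rho>))"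
      unfolding S using es \<alpha> by blast
    also have "\<dots> = snd (e (chosen_arg \<alpha> t \<rho>)) (profile V (\<rho> (chosen_arg \<alpha> t \<rho>)) (derived \<alpha> t \<rho>))"
      unfolding arg der ..
    also have "\<dots> = snd (eval (power_op V) e t) S"
      unfolding S profile_cong_diag[OF d] using et \<alpha>' by metis
    finally show "snd (eval (power_op V) e s) S = snd (eval (power_op V) e t) S" .
  qed
  moreover have "fst (eval (power_op V) e s) = fst (eval (power_op V) e t)"
    using es et term_class_cong[OF d] by metis
  ultimately show ?thesis by (rule prod_eqI[rotated])
qed

lemma compatible_power_digraph:
  fixes G :: "'x pair_pre_digraph"
  assumes G: "pverts G \<noteq> {}"
  shows "compatible_digraph V (disjoint_union (diagonals V) (\<lambda>c. digraph_power G (profiles V (rep c))))"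
    (is "compatible_digraph V ?D")
proof -
  have verts: "pverts ?D = (SIGMA c:diagonals V. profiles V (rep c) \<rightarrow>\<^sub>E pverts G)"
    by (simp add: disjoint_union_def digraph_power_def)
  have arcs: "(x, y) \<in> parcs ?D \<longleftrightarrow> x \<in> pverts ?D \<and> y \<in> pverts ?D \<and> fst x = fst y \<and>
      (\<forall>S\<in>profiles V (rep (fst x)). (snd x S, snd y S) \<in> parcs G)" for x y
    by (cases x; cases y) (auto simp: disjoint_union_def digraph_power_def)
  have closed: "power_op V f xs \<in> pverts ?D"
    if f: "f \<in> opsyms V" and len: "length xs = arity V f" and xs: "set xs \<subseteq> pverts ?D" for f xs
  proof -
    have dg: "fst ` set xs \<subseteq> diagonals V" using xs verts by auto
    note op = power_op_apply[OF V f len dg HOL.refl HOL.refl]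
    have "fst (power_op V f xs) \<in> diagonals V"
      unfolding op(3) by (rule rep_term_class(2)[OF V wf_subst[OF op(1) op(2)]])
    moreover have "snd (power_op V f xs) S \<in> pverts G"
      if S: "S \<in> profiles V (rep (fst (power_op V f xs)))" for S
    proof -
      obtain i S' where i: "i < length xs" "S' \<in> profiles V (rep (fst (xs ! i)))"
        "snd (power_op V f xs) S = snd (xs ! i) S'"
        using power_op_coordinate[OF f len dg S] by (elim exE conjE bexE) simp
      have "xs ! i \<in> pverts ?D" using xs i(1) by auto
      then show ?thesis using i(2,3) unfolding verts by (auto simp: in_Sigma_iff)
    qed
    ultimately show ?thesis
      using op(4) unfolding verts in_Sigma_iff by (simp add: PiE_def)
  qed
  show ?thesis
    unfolding compatible_digraph_def algebra_of_def
  proof (intro exI[of _ "power_op V"] conjI ballI)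
    have "term_class V (rename (\<lambda>_. 0) (Var 0)) \<in> diagonals V" by (rule rep_term_class(2)[OF V]) simp
    moreover obtain g where "g \<in> pverts G" using G by blast
    ultimately have "(term_class V (rename (\<lambda>_. 0) (Var 0)),
        \<lambda>S\<in>profiles V (rep (term_class V (rename (\<lambda>_. 0) (Var 0)))). g) \<in> pverts ?D"
      unfolding verts by auto
    then show "pverts ?D \<noteq> {}" by blast
  next
    fix f xs assume "f \<in> opsyms V" "xs \<in> nlists (arity V f) (pverts ?D)"
    then show "power_op V f xs \<in> pverts ?D" by (intro closed) (auto simp: nlists_def)
  next
    fix st assume st: "st \<in> idents V"
    obtain s t where eq: "st = (s, t)" by fastforce
    show "case st of (s, t) \<Rightarrow> \<forall>e. range e \<subseteq> pverts ?D \<longrightarrow> eval (power_op V) e s = eval (power_op V) e t"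
      unfolding eq prod.case
    proof (intro allI impI)
      fix e :: "nat \<Rightarrow> ('s, nat) trm set \<times> (('s, nat) trm set \<Rightarrow> 'x)"
      assume e: "range e \<subseteq> pverts ?D"
      have "\<forall>x. e x \<in> pverts ?D" using e by blast
      then have "\<forall>x. fst (e x) \<in> diagonals V \<and> snd (e x) \<in> extensional (profiles V (rep (fst (e x))))"
        unfolding verts by (simp add: in_Sigma_iff PiE_def)
      then show "eval (power_op V) e s = eval (power_op V) e t"
        by (rule eval_power_op_ident) (use st eq in simp)
    qed
  next
    fix f assume f: "f \<in> opsyms V"
    show "preserves (arity V f) (power_op V f) (parcs ?D)"
      unfolding preserves_def
    proof (intro allI impI, elim conjE)
      fix xs ys
      assume len: "length xs = arity V f" "length ys = arity V f"
        and E: "\<forall>i<arity V f. (xs ! i, ys ! i) \<in> parcs ?D"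
      have xs: "set xs \<subseteq> pverts ?D" and ys: "set ys \<subseteq> pverts ?D"
        using E len by (metis (no_types, lifting) arcs in_set_conv_nth subsetI)+
      have fst: "map fst ys = map fst xs"
        using E len unfolding arcs by (intro nth_equalityI) simp_all
      have dg: "fst ` set xs \<subseteq> diagonals V" using xs verts by auto
      have "(snd (power_op V f xs) S, snd (power_op V f ys) S) \<in> parcs G"
        if S: "S \<in> profiles V (rep (fst (power_op V f xs)))" for S
      proof -
        obtain i S' where i: "i < length xs" and S': "S' \<in> profiles V (rep (fst (xs ! i)))"
          and eq: "\<And>zs :: (('s, nat) trm set \<times> (('s, nat) trm set \<Rightarrow> 'x)) list. map fst zs = map fst xs \<Longrightarrow> snd (power_op V f zs) S = snd (zs ! i) S'"
          using power_op_coordinate[OF f len(1) dg S] by (elim exE conjE bexE) blast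
        have "(xs ! i, ys ! i) \<in> parcs ?D" using E i len by simp
        then show ?thesis using eq[of xs] eq[OF fst] S' by (simp add: arcs)
      qed
      then show "(power_op V f xs, power_op V f ys) \<in> parcs ?D"
        unfolding arcs using closed[OF f len(1) xs] closed[OF f len(2) ys] fst_power_op[OF fst, of f] by simp
    qed
  qed
qed

end

section \<open>Locally finite varieties\<close>

definition binary_terms :: "'s variety \<Rightarrow> ('s, nat) trm set" where
  "binary_terms V = {t. wf_trm V t \<and> vars t \<subseteq> {0, 1}}"

text \<open>
  These classes form the subalgebra of the free algebra that is generated by two of the free
  generators.
\<close>

lemma finite_binary_classes:
  fixes V :: "'s variety"
  assumes V: "wf_variety V" and lf: "locally_finite V"
  shows "finite (term_class V ` binary_terms V)"
proof -
  let ?B = "term_class V ` binary_terms V"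
  have sub: "?B \<subseteq> free_univ V"
    by (auto simp: free_univ_eq binary_terms_def term_class_def)
  have op: "free_op V f (map (term_class V) ts) = term_class V (Op f ts)"
    if "f \<in> opsyms V" "length ts = arity V f" "set ts \<subseteq> binary_terms V" for f ts
  proof -
    have "list_all (wf_trm V) ts" using that(3) by (auto simp: binary_terms_def list_all_iff)
    then show ?thesis using free_op_classes[OF that(1,2)] unfolding term_class_def[abs_def] by simp
  qed
  have list: "\<exists>ts. set ts \<subseteq> binary_terms V \<and> length ts = n \<and> cs = map (term_class V) ts"
    if "cs \<in> nlists n ?B" for cs n
  proof -
    have "cs \<in> lists ?B" and len: "length cs = n" using that by (auto simp: nlists_def)
    then obtain ts where "ts \<in> lists (binary_terms V)" "cs = map (term_class V) ts"
      unfolding lists_image by blast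
    then show ?thesis using len by auto
  qed
  have closed: "free_op V f cs \<in> ?B" if f: "f \<in> opsyms V" and cs: "cs \<in> nlists (arity V f) ?B" for f cs
  proof -
    obtain ts where ts: "set ts \<subseteq> binary_terms V" "length ts = arity V f" "cs = map (term_class V) ts"
      using list[OF cs] by blast
    then have "Op f ts \<in> binary_terms V" using f by (auto simp: binary_terms_def list_all_iff)
    then show ?thesis unfolding ts(3) op[OF f ts(2,1)] by (rule imageI)
  qed
  have "algebra_of V ?B (free_op V)"
    unfolding algebra_of_def
  proof (intro conjI ballI)
    have "Var 0 \<in> binary_terms V" by (simp add: binary_terms_def)
    then show "?B \<noteq> {}" by blast
    fix st assume st: "st \<in> idents V"
    have "\<forall>(s, t)\<in>idents V. \<forall>e. range e \<subseteq> free_univ V \<longrightarrow> eval (free_op V) e s = eval (free_op V) e t"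
      using free_algebra_of[OF V] unfolding algebra_of_def by blast
    then show "case st of (s, t) \<Rightarrow> \<forall>e. range e \<subseteq> ?B \<longrightarrow> eval (free_op V) e s = eval (free_op V) e t"
      using st sub by (force split: prod.splits)
  qed (rule closed)
  moreover have "finitely_generated V ?B (free_op V)"
    unfolding finitely_generated_def
  proof (intro exI[of _ "term_class V ` {Var 0, Var 1}"] conjI allI impI)
    show "term_class V ` {Var 0, Var 1} \<subseteq> ?B" by (auto simp: binary_terms_def)
    fix B assume B: "subuniverse V ?B (free_op V) B \<and> term_class V ` {Var 0, Var 1} \<subseteq> B"
    have "term_class V t \<in> B" if "t \<in> binary_terms V" for t
      using that
    proof (induction t)
      case (Var x)
      then show ?case using B by (auto simp: binary_terms_def)
    next
      case (Op f ts)
      have f: "f \<in> opsyms V" and len: "length ts = arity V f" and ts: "set ts \<subseteq> binary_terms V"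
        using Op.prems by (auto simp: binary_terms_def list_all_iff)
      have "map (term_class V) ts \<in> nlists (arity V f) B"
        using Op.IH ts len by (auto simp: nlists_def)
      then have "free_op V f (map (term_class V) ts) \<in> B"
        using B f unfolding subuniverse_def by blast
      then show ?case unfolding op[OF f len ts] .
    qed
    then show "B = ?B" using B by (auto simp: subuniverse_def)
  qed simp
  ultimately show ?thesis using lf unfolding locally_finite_def by blast
qed

lemma finite_diagonals:
  assumes "wf_variety V" "locally_finite V"
  shows "finite (diagonals V)"
  by (rule finite_subset[OF _ finite_binary_classes[OF assms]])
    (auto simp: diagonals_def binary_terms_def vars_subst intro!: imageI split: if_splits)

text \<open>
  A profile is determined by the classes of its members, since choosers respect the identities.
\<close>

lemma finite_profiles:
  assumes "wf_variety V" "locally_finite V"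
  shows "finite (profiles V r)"
proof (rule finite_subset)
  let ?B = "term_class V ` binary_terms V"
  \<comment> \<open>Recovers a profile from the set of classes of its members.\<close>
  let ?P = "\<lambda>Y. {s. same_diag V r s \<and> vars s \<subseteq> {0, 1} \<and> term_class V s \<in> Y}"
  show "finite (?P ` Pow ?B)" using finite_binary_classes[OF assms] by simp
  show "profiles V r \<subseteq> ?P ` Pow ?B"
  proof
    fix S assume "S \<in> profiles V r"
    then obtain \<alpha> where \<alpha>: "chooser V r \<alpha>" and S: "S = profile V r \<alpha>"
      by (auto simp: profiles_def)
    have "s \<in> S" if s: "same_diag V r s" "vars s \<subseteq> {0, 1}" "term_class V s \<in> term_class V ` S" for s
    proof -
      obtain s' where s': "s' \<in> S" "term_class V s = term_class V s'" using s(3) by blast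
      have d: "same_diag V r s'" "\<alpha> s' = 0" using s'(1) by (auto simp: S profile_def)
      have "eq_conseq V s' s"
        using s'(2) term_class_eq_iff[of V s s'] s(1) by (simp add: same_diag_def)
      then have "\<alpha> s = 0" using chooser_eq[OF \<alpha> d(1)] d(2) by simp
      then show ?thesis using s by (simp add: S profile_def)
    qed
    then have "S = ?P (term_class V ` S)" by (auto simp: S profile_def)
    moreover have "term_class V ` S \<in> Pow ?B"
      by (auto simp: S profile_def binary_terms_def same_diag_def intro!: imageI)
    ultimately show "S \<in> ?P ` Pow ?B" by blast
  qed
qed

section \<open>Term operations and interpretations\<close>

definition term_op :: "'s variety \<Rightarrow> nat \<Rightarrow> ('s, nat) trm \<Rightarrow> ('s, nat) trm set list \<Rightarrow> ('s, nat) trm set" where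
  "term_op V n t = (\<lambda>xs\<in>nlists n (free_univ V). eval (free_op V) (\<lambda>i. xs ! i) t)"

lemma variety_clone_iff:
  "f \<in> variety_clone V n \<longleftrightarrow> (\<exists>t. f = term_op V n t \<and> wf_trm V t \<and> vars t \<subseteq> {..<n})"
  by (auto simp: variety_clone_def term_op_def)

lemma projection_eq_term_op: "projection (free_univ V) n i = term_op V n (Var i)"
  by (simp add: projection_def term_op_def)

text \<open>
  Soundness concerns assignments of all variables with values in the universe, whereas the operations
  of a clone evaluate terms at lists, which are undefined beyond their length.
\<close>

lemma eval_padded:
  assumes "xs \<in> nlists n (free_univ V)" "vars t \<subseteq> {..<n}"
  obtains e where "range e \<subseteq> free_univ V" "\<And>i. i < n \<Longrightarrow> e i = xs ! i"
    "eval I (\<lambda>i. xs ! i) t = eval I e t"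
proof
  let ?e = "\<lambda>i. if i < n then xs ! i else free_gen V 0"
  show "range ?e \<subseteq> free_univ V" using assms(1) free_gen_in by (auto simp: nlists_def)
  show "eval I (\<lambda>i. xs ! i) t = eval I ?e t" using assms(2) by (intro eval_cong) auto
qed simp

context
  fixes V :: "'s variety"
  assumes V: "wf_variety V"
begin

lemma eval_free_univ_iff:
  assumes "wf_trm V s" "wf_trm V t"
  shows "eq_conseq V s t \<longleftrightarrow> (\<forall>e. range e \<subseteq> free_univ V \<longrightarrow> eval (free_op V) e s = eval (free_op V) e t)"
proof
  assume "eq_conseq V s t"
  then show "\<forall>e. range e \<subseteq> free_univ V \<longrightarrow> eval (free_op V) e s = eval (free_op V) e t"
    using eq_conseq_sound[OF free_algebra_of[OF V]] by blast
next
  assume eq: "\<forall>e. range e \<subseteq> free_univ V \<longrightarrow> eval (free_op V) e s = eval (free_op V) e t"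
  have "range (free_gen V) \<subseteq> free_univ V" using free_gen_in by blast
  then have "eval (free_op V) (free_gen V) s = eval (free_op V) (free_gen V) t" using eq by blast
  moreover have "eval (free_op V) (free_gen V) u = term_class V u" if "wf_trm V u" for u
    using eval_free[OF that, of Var] by (simp add: free_gen_def[abs_def] term_class_def)
  ultimately show "eq_conseq V s t" using assms by (simp add: term_class_eq_iff)
qed

lemma term_op_eq_iff:
  assumes "wf_trm V s" "wf_trm V t" "vars s \<subseteq> {..<n}" "vars t \<subseteq> {..<n}"
  shows "term_op V n s = term_op V n t \<longleftrightarrow> eq_conseq V s t"
proof
  assume eq: "term_op V n s = term_op V n t"
  have "eval (free_op V) e s = eval (free_op V) e t" if e: "range e \<subseteq> free_univ V" for e
  proof -
    let ?xs = "map e [0..<n]"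
    have "?xs \<in> nlists n (free_univ V)" using e by (auto simp: nlists_def)
    then have "eval (free_op V) (\<lambda>i. ?xs ! i) s = eval (free_op V) (\<lambda>i. ?xs ! i) t"
      using fun_cong[OF eq, of ?xs] by (simp add: term_op_def)
    moreover have "eval (free_op V) (\<lambda>i. ?xs ! i) u = eval (free_op V) e u" if "vars u \<subseteq> {..<n}" for u
      using that by (intro eval_cong) auto
    ultimately show ?thesis using assms by simp
  qed
  then show "eq_conseq V s t" using eval_free_univ_iff[OF assms(1,2)] by blast
next
  assume eq: "eq_conseq V s t"
  show "term_op V n s = term_op V n t"
    unfolding term_op_def
  proof (rule restrict_ext)
    fix xs assume xs: "xs \<in> nlists n (free_univ V)"
    let ?e = "\<lambda>i. if i < n then xs ! i else free_gen V 0"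
    have "range ?e \<subseteq> free_univ V" using xs free_gen_in by (auto simp: nlists_def)
    then have "eval (free_op V) ?e s = eval (free_op V) ?e t"
      using eq eq_conseq_sound[OF free_algebra_of[OF V]] by blast
    moreover have "eval (free_op V) (\<lambda>i. xs ! i) u = eval (free_op V) ?e u" if "vars u \<subseteq> {..<n}" for u
      using that by (intro eval_cong) auto
    ultimately show "eval (free_op V) (\<lambda>i. xs ! i) s = eval (free_op V) (\<lambda>i. xs ! i) t"
      using assms by simp
  qed
qed

lemma composition_term_op:
  assumes t: "wf_trm V t" "vars t \<subseteq> {..<m}"
    and \<sigma>: "\<And>i. i < m \<Longrightarrow> wf_trm V (\<sigma> i) \<and> vars (\<sigma> i) \<subseteq> {..<n}"
  shows "composition (free_univ V) n (term_op V m t) (map (\<lambda>i. term_op V n (\<sigma> i)) [0..<m])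
    = term_op V n (subst \<sigma> t)"
  unfolding composition_def term_op_def[of V n "subst \<sigma> t"]
proof (rule restrict_ext)
  fix xs assume xs: "xs \<in> nlists n (free_univ V)"
  let ?ys = "map (\<lambda>g. g xs) (map (\<lambda>i. term_op V n (\<sigma> i)) [0..<m])"
  have "term_op V n (\<sigma> i) xs \<in> free_univ V" if "i < m" for i
  proof -
    have \<sigma>i: "wf_trm V (\<sigma> i)" "vars (\<sigma> i) \<subseteq> {..<n}" using \<sigma>[OF that] by simp_all
    obtain e where e: "range e \<subseteq> free_univ V"
        "eval (free_op V) (\<lambda>i. xs ! i) (\<sigma> i) = eval (free_op V) e (\<sigma> i)"
      by (rule eval_padded[OF xs \<sigma>i(2)])
    show ?thesis
      using eval_in_universe[OF free_algebra_of[OF V] e(1) \<sigma>i(1)] xs by (simp add: term_op_def e(2))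
  qed
  then have "?ys \<in> nlists m (free_univ V)" by (auto simp: nlists_def)
  then have "term_op V m t ?ys = eval (free_op V) (\<lambda>i. ?ys ! i) t" by (simp add: term_op_def)
  also have "\<dots> = eval (free_op V) (\<lambda>i. eval (free_op V) (\<lambda>i. xs ! i) (\<sigma> i)) t"
    using t(2) xs by (intro eval_cong) (auto simp: term_op_def)
  finally show "term_op V m t ?ys = eval (free_op V) (\<lambda>i. xs ! i) (subst \<sigma> t)"
    by (simp add: eval_subst)
qed

lemma variety_clone_listE:
  assumes "gs \<in> nlists m (variety_clone V n)" "n \<ge> 1"
  obtains \<sigma> where "gs = map (\<lambda>i. term_op V n (\<sigma> i)) [0..<m]"
    "\<And>i. wf_trm V (\<sigma> i)" "\<And>i. vars (\<sigma> i) \<subseteq> {..<n}"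
proof -
  have len: "length gs = m" and gs: "set gs \<subseteq> variety_clone V n" using assms(1) by (auto simp: nlists_def)
  have "\<forall>i. \<exists>t. wf_trm V t \<and> vars t \<subseteq> {..<n} \<and> (i < m \<longrightarrow> gs ! i = term_op V n t)"
  proof
    fix i
    show "\<exists>t. wf_trm V t \<and> vars t \<subseteq> {..<n} \<and> (i < m \<longrightarrow> gs ! i = term_op V n t)"
    proof (cases "i < m")
      case True
      then have "gs ! i \<in> variety_clone V n" using gs len nth_mem by blast
      then show ?thesis by (auto simp: variety_clone_iff)
    next
      case False
      then show ?thesis using assms(2) by (intro exI[of _ "Var 0"]) auto
    qed
  qed
  from choice[OF this] obtain \<sigma> where \<sigma>: "\<And>i. wf_trm V (\<sigma> i) \<and> vars (\<sigma> i) \<subseteq> {..<n} \<and> (i < m \<longrightarrow> gs ! i = term_op V n (\<sigma> i))"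
    by blast
  show ?thesis
  proof
    show "gs = map (\<lambda>i. term_op V n (\<sigma> i)) [0..<m]" using \<sigma> len by (intro nth_equalityI) auto
  qed (use \<sigma> in auto)
qed

end

text \<open>
  Replaces every operation symbol \<open>f\<close> by the term \<open>d f\<close>, whose variable \<open>i\<close> stands for the
  argument with index \<open>i\<close>.
\<close>

primrec translate :: "('r \<Rightarrow> ('s, nat) trm) \<Rightarrow> ('r, nat) trm \<Rightarrow> ('s, nat) trm" where
  "translate d (Var x) = Var x"
| "translate d (Op f ts) = subst (\<lambda>i. if i < length ts then map (translate d) ts ! i else Var 0) (d f)"

text \<open>
  If the terms \<open>d f\<close>, evaluated in the free algebra of \<open>V\<close>, satisfy the identities of \<open>W\<close>, then
  soundness for the resulting algebra shows that translation respects equational consequence in \<open>W\<close>.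
  Hence it is well defined on the operations of the clone of \<open>W\<close>.
\<close>

lemma interpretsI:
  fixes V :: "'s variety" and W :: "'r variety"
  assumes V: "wf_variety V" and W: "wf_variety W"
    and d: "\<And>f. f \<in> opsyms W \<Longrightarrow> wf_trm V (d f) \<and> vars (d f) \<subseteq> {..<arity W f}"
    and alg: "algebra_of W (free_univ V) (\<lambda>f xs. eval (free_op V) (\<lambda>i. xs ! i) (d f))"
      (is "algebra_of W _ ?J")
  shows "interprets W V"
proof -
  let ?tr = "translate d"
  have wf_tr: "wf_trm V (?tr t)" if "wf_trm W t" for t
    using that
  proof (induction t)
    case (Op f ts)
    then have "wf_trm V (?tr s)" if "s \<in> set ts" for s using that by (simp add: list_all_iff)
    then show ?case using d[of f] Op.prems by (simp add: wf_subst)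
  qed simp
  have vars_tr: "vars (?tr t) \<subseteq> vars t" if "wf_trm W t" for t
    using that
  proof (induction t)
    case (Op f ts)
    have "vars (?tr s) \<subseteq> vars s" if "s \<in> set ts" for s using that Op by (simp add: list_all_iff)
    moreover have "i < length ts" if "i \<in> vars (d f)" for i using d[of f] Op.prems that by auto
    ultimately have "vars (if i < length ts then map ?tr ts ! i else Var 0) \<subseteq> vars (Op f ts)"
      if "i \<in> vars (d f)" for i
      using that nth_mem[of i ts] by (simp, blast)
    then show ?case unfolding translate.simps vars_subst by blast
  qed simp
  have eval_tr: "eval (free_op V) e (?tr t) = eval ?J e t" if "wf_trm W t" for e t
    using that
  proof (induction t)
    case (Op f ts)
    have "eval (free_op V) e (?tr s) = eval ?J e s" if "s \<in> set ts" for s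
      using that Op by (simp add: list_all_iff)
    moreover have "i < length ts" if "i \<in> vars (d f)" for i using d[of f] Op.prems that by auto
    ultimately show ?case by (simp add: eval_subst) (intro eval_cong, simp)
  qed simp
  have tr_subst: "?tr (subst \<sigma> t) = subst (\<lambda>i. ?tr (\<sigma> i)) (?tr t)" if "wf_trm W t" for \<sigma> t
    using that
  proof (induction t)
    case (Op f ts)
    have "?tr (subst \<sigma> s) = subst (\<lambda>i. ?tr (\<sigma> i)) (?tr s)" if "s \<in> set ts" for s
      using that Op by (simp add: list_all_iff)
    moreover have "i < length ts" if "i \<in> vars (d f)" for i using d[of f] Op.prems that by auto
    ultimately show ?case by (simp add: subst_subst) (intro subst_cong, simp)
  qed simp
  have eq_tr: "eq_conseq V (?tr s) (?tr t)" if st: "eq_conseq W s t" for s t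
  proof -
    have ws: "wf_trm W s" and wt: "wf_trm W t" using eq_conseq_wf[OF W st] by simp_all
    have "eval (free_op V) e (?tr s) = eval (free_op V) e (?tr t)" if "range e \<subseteq> free_univ V" for e
      unfolding eval_tr[OF ws] eval_tr[OF wt] by (rule eq_conseq_sound[OF alg that st])
    then show ?thesis using eval_free_univ_iff[OF V wf_tr[OF ws] wf_tr[OF wt]] by blast
  qed
  define \<phi> where "\<phi> n f = term_op V n (?tr (SOME t. f = term_op W n t \<and> wf_trm W t \<and> vars t \<subseteq> {..<n}))" for n f
  have \<phi>: "\<phi> n (term_op W n t) = term_op V n (?tr t)" if t: "wf_trm W t" "vars t \<subseteq> {..<n}" for n t
  proof -
    let ?s = "SOME s. term_op W n t = term_op W n s \<and> wf_trm W s \<and> vars s \<subseteq> {..<n}"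
    have s: "term_op W n t = term_op W n ?s \<and> wf_trm W ?s \<and> vars ?s \<subseteq> {..<n}"
      by (rule someI[of _ t]) (use t in simp)
    then have "eq_conseq W ?s t" using term_op_eq_iff[OF W, of ?s t n] t by metis
    then have "eq_conseq V (?tr ?s) (?tr t)" by (rule eq_tr)
    moreover have "vars (?tr ?s) \<subseteq> {..<n}" "vars (?tr t) \<subseteq> {..<n}"
      using vars_tr[of ?s] vars_tr[of t] s t by blast+
    ultimately show ?thesis
      unfolding \<phi>_def using term_op_eq_iff[OF V wf_tr wf_tr, of ?s t n] s t by blast
  qed
  have "clone_hom (free_univ W) (variety_clone W) (free_univ V) (variety_clone V) \<phi>"
    unfolding clone_hom_def
  proof (intro conjI allI impI ballI)
    fix n f assume "f \<in> variety_clone W n"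
    then obtain t where t: "f = term_op W n t" "wf_trm W t" "vars t \<subseteq> {..<n}"
      unfolding variety_clone_iff by blast
    then show "\<phi> n f \<in> variety_clone V n"
      unfolding variety_clone_iff t(1) \<phi>[OF t(2,3)] using wf_tr vars_tr by blast
  next
    fix n i :: nat assume "i < n"
    then show "\<phi> n (projection (free_univ W) n i) = projection (free_univ V) n i"
      unfolding projection_eq_term_op by (subst \<phi>) simp_all
  next
    fix m n :: nat and f gs
    assume n: "1 \<le> n" and f: "f \<in> variety_clone W m" and gs: "gs \<in> nlists m (variety_clone W n)"
    obtain t where t: "f = term_op W m t" "wf_trm W t" "vars t \<subseteq> {..<m}"
      using f unfolding variety_clone_iff by blast
    obtain \<sigma> where \<sigma>: "gs = map (\<lambda>i. term_op W n (\<sigma> i)) [0..<m]"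
        "\<And>i. wf_trm W (\<sigma> i)" "\<And>i. vars (\<sigma> i) \<subseteq> {..<n}"
      by (rule variety_clone_listE[OF W gs n], rule that) auto
    have "\<phi> n (composition (free_univ W) n f gs) = \<phi> n (term_op W n (subst \<sigma> t))"
      unfolding t(1) \<sigma>(1) using \<sigma>(2,3) by (subst composition_term_op[OF W t(2,3)]) auto
    also have "\<dots> = term_op V n (subst (\<lambda>i. ?tr (\<sigma> i)) (?tr t))"
      unfolding tr_subst[OF t(2), symmetric]
      by (rule \<phi>) (use \<sigma> t in \<open>auto simp: wf_subst vars_subst\<close>)
    also have "\<dots> = composition (free_univ V) n (term_op V m (?tr t)) (map (\<lambda>i. term_op V n (?tr (\<sigma> i))) [0..<m])"
      using vars_tr[OF t(2)] t(3) vars_tr[OF \<sigma>(2)] \<sigma>(3) wf_tr[OF \<sigma>(2)]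
      by (intro composition_term_op[OF V wf_tr[OF t(2)], symmetric]) blast+
    also have "map (\<lambda>i. term_op V n (?tr (\<sigma> i))) [0..<m] = map (\<phi> n) gs"
      unfolding \<sigma>(1) by (simp add: \<phi> \<sigma>)
    finally show "\<phi> n (composition (free_univ W) n f gs) = composition (free_univ V) n (\<phi> m f) (map (\<phi> n) gs)"
      unfolding t(1) \<phi>[OF t(2,3)] .
  qed
  then show ?thesis unfolding interprets_def by blast
qed

lemma wf_SET: "wf_variety SET"
  by (simp add: wf_variety_def SET_def)

lemma SET_Var_inj: "eq_conseq SET (Var i) (Var j) \<Longrightarrow> i = j"
  using eq_conseq_sound[of SET UNIV "\<lambda>_ _. 0 :: nat" id "Var i" "Var j"]
  by (simp add: algebra_of_def SET_def)

lemma variety_clone_SET: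
  assumes "f \<in> variety_clone SET n"
  shows "\<exists>i<n. f = term_op SET n (Var i)"
proof -
  obtain t where t: "f = term_op SET n t" "wf_trm SET t" "vars t \<subseteq> {..<n}"
    using assms unfolding variety_clone_iff by blast
  then show ?thesis by (cases t) (auto simp: SET_def)
qed

section \<open>Choosers for the idempotent terms of a non-Taylor variety\<close>

text \<open>
  Tychonoff's theorem for the product of the finite discrete spaces \<open>F i\<close>. A constraint on two
  coordinates defines a closed subset.
\<close>

lemma binary_constraints_compact:
  fixes F :: "'i \<Rightarrow> 'v set" and P :: "('i \<times> 'i \<times> ('v \<Rightarrow> 'v \<Rightarrow> bool)) set"
  assumes fin: "\<And>i. finite (F i)"
    and sat: "\<And>P0. finite P0 \<Longrightarrow> P0 \<subseteq> P \<Longrightarrow> \<exists>\<alpha>. (\<forall>i. \<alpha> i \<in> F i) \<and> (\<forall>(i, j, R)\<in>P0. R (\<alpha> i) (\<alpha> j))"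
  shows "\<exists>\<alpha>. (\<forall>i. \<alpha> i \<in> F i) \<and> (\<forall>(i, j, R)\<in>P. R (\<alpha> i) (\<alpha> j))"
proof -
  let ?X = "product_topology (\<lambda>i. discrete_topology (F i)) UNIV"
  have top: "topspace ?X = Pi UNIV F" by (simp add: PiE_def)
  define sol where "sol = (\<lambda>(i, j, R). {\<alpha> \<in> topspace ?X. R (\<alpha> i) (\<alpha> j :: 'v)})"
  have value_closed: "closedin ?X {\<alpha> \<in> topspace ?X. \<alpha> i \<in> A}" if "A \<subseteq> F i" for i A
    by (rule closedin_continuous_map_preimage[OF continuous_map_product_projection]) (use that in simp_all)
  have closed: "closedin ?X (sol p)" for p
  proof -
    obtain i j R where p: "p = (i, j, R)" by (cases p)
    have "sol p = (\<Union>v\<in>F i. {\<alpha> \<in> topspace ?X. \<alpha> i \<in> {v}} \<inter> {\<alpha> \<in> topspace ?X. \<alpha> j \<in> {w\<in>F j. R v w}})"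
      by (auto simp: sol_def p top Pi_iff)
    moreover have "closedin ?X ({\<alpha> \<in> topspace ?X. \<alpha> i \<in> {v}} \<inter> {\<alpha> \<in> topspace ?X. \<alpha> j \<in> {w\<in>F j. R v w}})"
      if "v \<in> F i" for v
      by (rule closedin_Int[OF value_closed value_closed]) (use that in auto)
    ultimately show ?thesis using fin[of i] by (simp only:) (rule closedin_Union, auto)
  qed
  have "compact_space ?X"
    unfolding compact_space_product_topology compact_space_discrete_topology using fin by blast
  moreover have "\<Inter>\<F> \<noteq> {}" if F: "finite \<F>" "\<F> \<subseteq> insert (topspace ?X) (sol ` P)" for \<F>
  proof -
    obtain P0 where P0: "P0 \<subseteq> P" "finite P0" "\<F> - {topspace ?X} = sol ` P0"
      by (rule finite_subset_image[of "\<F> - {topspace ?X}" sol P, THEN exE]) (use F in blast)+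
    obtain \<alpha> where \<alpha>: "\<forall>i. \<alpha> i \<in> F i" "\<forall>(i, j, R)\<in>P0. R (\<alpha> i) (\<alpha> j)"
      using sat[OF P0(2,1)] by blast
    have tX: "\<alpha> \<in> topspace ?X" unfolding top Pi_iff using \<alpha>(1) by blast
    have sol: "\<alpha> \<in> sol p" if "p \<in> P0" for p
      using bspec[OF \<alpha>(2) that] tX unfolding sol_def by (cases p) simp
    have "\<alpha> \<in> S" if "S \<in> \<F>" for S
    proof (cases "S = topspace ?X")
      case False
      then have "S \<in> sol ` P0" using that unfolding P0(3)[symmetric] by blast
      then show ?thesis using sol by blast
    qed (use tX in simp)
    then show ?thesis by blast
  qed
  moreover have "\<forall>C\<in>insert (topspace ?X) (sol ` P). closedin ?X C" using closed by blast
  ultimately have "\<Inter>(insert (topspace ?X) (sol ` P)) \<noteq> {}"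
    unfolding compact_space_fip
    by (elim allE[where x = "insert (topspace ?X) (sol ` P)"]) (erule mp, intro conjI allI impI, assumption, elim conjE, assumption)
  then obtain \<alpha> where "\<alpha> \<in> \<Inter>(insert (topspace ?X) (sol ` P))" unfolding ex_in_conv[symmetric] by (rule exE)
  then have \<alpha>: "\<alpha> \<in> topspace ?X" "\<And>p. p \<in> P \<Longrightarrow> \<alpha> \<in> sol p" by simp_all
  have "R (\<alpha> i) (\<alpha> j)" if "(i, j, R) \<in> P" for i j R
    using \<alpha>(2)[OF that] by (simp add: sol_def)
  moreover have "\<alpha> i \<in> F i" for i using \<alpha>(1) unfolding top Pi_iff by blast
  ultimately show ?thesis by (intro exI[of _ \<alpha>]) auto
qed

text \<open>
  The finitely many constraints become a strong Maltsev condition. Its symbols name the terms that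
  occur; each symbol is declared idempotent, and a constraint \<open>(s, t, \<sigma>)\<close> becomes the identity that
  equates the symbol of \<open>s\<close>, with its variables renamed by \<open>\<sigma>\<close>, to the symbol of \<open>t\<close>. As \<open>V\<close> admits
  this condition and is not Taylor, it is satisfied by projections. The value at a term is the
  coordinate to which the symbol of the term projects.
\<close>

lemma non_Taylor_finite_chooser:
  fixes V :: "'s variety"
  assumes V: "wf_variety V" and nT: "\<not> Taylor V"
    and C: "finite C" "\<And>s t \<sigma>. (s, t, \<sigma>) \<in> C \<Longrightarrow> same_diag V (Var 0) s \<and> eq_conseq V (rename \<sigma> s) t"
  shows "\<exists>\<alpha>. (\<forall>t. \<alpha> t \<in> insert 0 (vars t)) \<and> (\<forall>(s, t, \<sigma>)\<in>C. \<alpha> t = \<sigma> (\<alpha> s))"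
proof -
  define D where "D = fst ` C \<union> (fst \<circ> snd) ` C"
  have finD: "finite D" using C(1) by (simp add: D_def)
  have D: "same_diag V (Var 0) t" if t: "t \<in> D" for t
  proof -
    from t consider \<sigma> u where "(t, u, \<sigma>) \<in> C" | s \<sigma> where "(s, t, \<sigma>) \<in> C"
      by (auto simp: D_def)
    then show ?thesis
    proof cases
      case 2
      then have s: "same_diag V (Var 0) s" "eq_conseq V (rename \<sigma> s) t" using C(2) by blast+
      show ?thesis
        by (rule same_diag_trans[OF same_diag_trans[OF s(1) same_diag_rename] eq_conseq_same_diag[OF V s(2)]])
          (use s(1) in \<open>simp add: same_diag_def\<close>)
    qed (use C(2) in blast)
  qed
  then have wfD: "wf_trm V t" if "t \<in> D" for t using that by (simp add: same_diag_def)
  \<comment> \<open>The additional constraints \<open>(t, t, away t)\<close> force the value at \<open>t\<close> to be a variable of \<open>t\<close>.\<close>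
  define away where "away t x = (if x \<in> vars t then x else Suc x)" for t :: "('s, nat) trm" and x :: nat
  have away: "rename (away t) t = t" for t :: "('s, nat) trm"
  proof -
    have "rename (away t) t = subst Var t" by (rule subst_cong) (simp add: away_def)
    then show ?thesis by simp
  qed
  define C' where "C' = C \<union> (\<lambda>t. (t, t, away t)) ` D"
  have finC': "finite C'" using C(1) finD by (simp add: C'_def)
  have C': "s \<in> D" "t \<in> D" "eq_conseq V (rename \<sigma> s) t" if "(s, t, \<sigma>) \<in> C'" for s t \<sigma>
  proof -
    have "(s, t, \<sigma>) \<in> C \<or> t = s \<and> \<sigma> = away s \<and> s \<in> D" using that by (auto simp: C'_def)
    then show "s \<in> D" "t \<in> D" "eq_conseq V (rename \<sigma> s) t"
      using C(2)[of s t \<sigma>] away[of s] eq_conseq.refl[OF wfD] by (force simp: D_def)+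
  qed
  obtain code :: "('s, nat) trm \<Rightarrow> nat" where code: "inj_on code D"
    using finite_imp_inj_to_nat_seg[OF finD] by blast
  define decode where "decode = inv_into D code"
  have decode: "decode (code t) = t" if "t \<in> D" for t
    unfolding decode_def by (rule inv_into_f_f[OF code that])
  \<comment> \<open>All symbols get the same arity, which bounds all variables and is positive.\<close>
  define N where "N = Suc (Max (insert 0 (\<Union>(vars ` D))))"
  have N: "vars t \<subseteq> {..<N}" if "t \<in> D" for t
  proof
    fix x assume "x \<in> vars t"
    then have "x \<le> Max (insert 0 (\<Union>(vars ` D)))" using that finD by (intro Max_ge) auto
    then show "x \<in> {..<N}" by (simp add: N_def)
  qed
  have N1: "1 \<le> N" by (simp add: N_def)
  define op where "op t \<sigma> = (Op (code t) (map (\<lambda>i. Var (\<sigma> i)) [0..<N]) :: (nat, nat) trm)" for t and \<sigma> :: "nat \<Rightarrow> nat"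
  define M where "M = (\<lambda>t. (op t (\<lambda>_. 0), Var 0)) ` D \<union> (\<lambda>(s, t, \<sigma>). (op s \<sigma>, op t (\<lambda>i. i))) ` C'"
  have M_cases [consumes 1]: thesis
    if p: "p \<in> M" and idem: "\<And>t. t \<in> D \<Longrightarrow> p = (op t (\<lambda>_. 0), Var 0) \<Longrightarrow> thesis"
      and minor: "\<And>s t \<sigma>. (s, t, \<sigma>) \<in> C' \<Longrightarrow> p = (op s \<sigma>, op t (\<lambda>i. i)) \<Longrightarrow> thesis" for p thesis
  proof (cases "p \<in> (\<lambda>t. (op t (\<lambda>_. 0), Var 0)) ` D")
    case True
    then show thesis using idem by blast
  next
    case False
    then obtain q where q: "q \<in> C'" "p = (\<lambda>(s, t, \<sigma>). (op s \<sigma>, op t (\<lambda>i. i))) q"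
      using p unfolding M_def by blast
    show thesis by (rule prod_cases3[of q], rule minor) (use q in auto)
  qed
  define a where "a = (\<lambda>_ :: nat. N)"
  define W where "W = defined_by a M"
  have opsyms: "opsyms W = code ` D"
  proof
    show "opsyms W \<subseteq> code ` D"
    proof
      fix f assume "f \<in> opsyms W"
      then obtain p where p: "p \<in> M" "f \<in> syms (fst p) \<union> syms (snd p)"
        unfolding W_def defined_by_def by auto
      from p(1) show "f \<in> code ` D"
        by (cases rule: M_cases) (use p(2) C'(1,2) in \<open>auto simp: op_def\<close>)
    qed
    have "code t \<in> opsyms W" if "t \<in> D" for t
    proof -
      have "(op t (\<lambda>_. 0), Var 0) \<in> M" using that unfolding M_def by blast
      moreover have "code t \<in> syms (op t (\<lambda>_. 0))" by (simp add: op_def)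
      ultimately show ?thesis unfolding W_def defined_by_def by fastforce
    qed
    then show "code ` D \<subseteq> opsyms W" by blast
  qed
  have arity: "arity W = a" unfolding W_def defined_by_def by simp
  have idents: "idents W = M" unfolding W_def defined_by_def by simp
  have wf_op: "wf_trm W (op t \<sigma>)" if "t \<in> D" for t \<sigma>
    using that by (auto simp: op_def opsyms arity a_def list_all_iff)
  have W: "wf_variety W"
    unfolding wf_variety_def idents
  proof (intro ballI)
    fix p assume "p \<in> M"
    then show "case p of (s, t) \<Rightarrow> wf_trm W s \<and> wf_trm W t"
      by (cases rule: M_cases) (simp_all add: wf_op C'(1,2))
  qed
  have ident_idem: "(op t (\<lambda>_. 0), Var 0) \<in> idents W" if "t \<in> D" for t
    using that by (auto simp: idents M_def)
  have ident_C': "(op s \<sigma>, op t (\<lambda>i. i)) \<in> idents W" if "(s, t, \<sigma>) \<in> C'" for s t \<sigma>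
    using that unfolding idents M_def by force
  have conseq: "eq_conseq W s t" if "(s, t) \<in> idents W" for s t
    using eq_conseq.ident[OF that, of Var] by simp
  have "strong_Maltsev a M"
    using finD finC' W by (simp add: strong_Maltsev_def W_def M_def)
  moreover have "idempotent_variety W"
    unfolding idempotent_variety_def
  proof (intro allI impI ballI)
    fix n f x assume n: "1 \<le> n" and f: "f \<in> variety_clone W n" and x: "x \<in> free_univ W"
    obtain t where t: "f = term_op W n t" "wf_trm W t" "vars t \<subseteq> {..<n}"
      using f unfolding variety_clone_iff by blast
    have "eval (free_op W) (\<lambda>_. x) s = x" if "wf_trm W s" for s :: "(nat, nat) trm"
      using that
    proof (induction s)
      case (Op g ss)
      obtain t where t: "t \<in> D" "g = code t" using Op.prems by (auto simp: opsyms)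
      have len: "length ss = N" using Op.prems by (simp add: arity a_def)
      have ss: "map (eval (free_op W) (\<lambda>_. x)) ss = replicate N x"
        using Op by (auto simp: list_all_iff list_eq_iff_nth_eq len)
      have "range (\<lambda>_ :: nat. x) \<subseteq> free_univ W" using x by auto
      note eq_conseq_sound[OF free_algebra_of[OF W] this conseq[OF ident_idem[OF t(1)]]]
      then show ?case unfolding t(2) eval.simps ss by (simp add: op_def comp_def map_replicate_const)
    qed simp
    moreover have "eval (free_op W) (\<lambda>i. replicate n x ! i) t = eval (free_op W) (\<lambda>_. x) t"
      using t(3) by (intro eval_cong) auto
    moreover have "replicate n x \<in> nlists n (free_univ W)" using x by (auto simp: nlists_def)
    ultimately show "f (replicate n x) = x" using t(2) by (simp add: t(1) term_op_def)
  qed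
  moreover have "interprets W V"
  proof (rule interpretsI[OF V W, of decode])
    show "wf_trm V (decode f) \<and> vars (decode f) \<subseteq> {..<arity W f}" if f: "f \<in> opsyms W" for f
    proof -
      obtain t where t: "t \<in> D" "f = code t" using f by (auto simp: opsyms)
      show ?thesis unfolding t(2) decode[OF t(1)] using wfD[OF t(1)] N[OF t(1)] by (simp add: arity a_def)
    qed
    let ?J = "\<lambda>f xs. eval (free_op V) (\<lambda>i. xs ! i) (decode f)"
    have eval_op: "eval ?J e (op t \<sigma>) = eval (free_op V) (\<lambda>i. e (\<sigma> i)) t" if "t \<in> D" for e t \<sigma>
    proof -
      have "eval ?J e (op t \<sigma>) = eval (free_op V) (\<lambda>i. map (\<lambda>i. e (\<sigma> i)) [0..<N] ! i) t"
        by (simp add: op_def decode[OF that] comp_def)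
      also have "\<dots> = eval (free_op V) (\<lambda>i. e (\<sigma> i)) t"
        using N[OF that] by (intro eval_cong) auto
      finally show ?thesis .
    qed
    note sound = eq_conseq_sound[OF free_algebra_of[OF V]]
    have eval_rename: "eval (free_op V) (\<lambda>i. e (\<sigma> i)) t = eval (free_op V) e (rename \<sigma> t)" for e \<sigma> t
      by (simp add: eval_subst)
    show "algebra_of W (free_univ V) ?J"
      unfolding algebra_of_def
    proof (intro conjI ballI)
      show "free_univ V \<noteq> {}" using free_gen_in[of V 0] by blast
      fix f xs assume "f \<in> opsyms W" and xs: "xs \<in> nlists (arity W f) (free_univ V)"
      then obtain t where t: "t \<in> D" "f = code t" by (auto simp: opsyms)
      obtain e where e: "range e \<subseteq> free_univ V"
          "eval (free_op V) (\<lambda>i. xs ! i) t = eval (free_op V) e t"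
        by (rule eval_padded[OF xs, of t]) (use N[OF t(1)] in \<open>simp_all add: arity a_def\<close>)
      show "eval (free_op V) (\<lambda>i. xs ! i) (decode f) \<in> free_univ V"
        unfolding t(2) decode[OF t(1)] e(2)
        by (rule eval_in_universe[OF free_algebra_of[OF V] e(1) wfD[OF t(1)]])
    next
      fix st assume "st \<in> idents W"
      then consider t where "t \<in> D" "st = (op t (\<lambda>_. 0), Var 0)"
        | s t \<sigma> where "(s, t, \<sigma>) \<in> C'" "st = (op s \<sigma>, op t (\<lambda>i. i))"
        unfolding idents using M_cases by metis
      then show "case st of (s, t) \<Rightarrow> \<forall>e. range e \<subseteq> free_univ V \<longrightarrow> eval ?J e s = eval ?J e t"
      proof cases
        case 1
        have "eval ?J e (op t (\<lambda>_. 0)) = e 0" if "range e \<subseteq> free_univ V" for e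
          unfolding eval_op[OF 1(1)] eval_rename[of e "\<lambda>_. 0"]
          using sound[OF that, of "rename (\<lambda>_. 0) t" "Var 0"] same_diag_sym[OF D[OF 1(1)]]
          by (simp add: same_diag_def)
        then show ?thesis by (simp add: 1(2))
      next
        case 2
        have "eval ?J e (op s \<sigma>) = eval ?J e (op t (\<lambda>i. i))" if "range e \<subseteq> free_univ V" for e
          unfolding eval_op[OF C'(1)[OF 2(1)]] eval_op[OF C'(2)[OF 2(1)]] eval_rename[of e \<sigma>]
          by (rule sound[OF that C'(3)[OF 2(1)]])
        then show ?thesis by (simp add: 2(2))
      qed
    qed
  qed
  ultimately have "interprets W SET"
    using nT unfolding Taylor_def admits_def W_def by blast
  then obtain \<phi> where \<phi>: "clone_hom (free_univ W) (variety_clone W) (free_univ SET) (variety_clone SET) \<phi>"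
    unfolding interprets_def by blast
  have hom_comp: "\<phi> n (composition (free_univ W) n f gs) = composition (free_univ SET) n (\<phi> m f) (map (\<phi> n) gs)"
    if "1 \<le> m" "1 \<le> n" "f \<in> variety_clone W m" "gs \<in> nlists m (variety_clone W n)" for m n f gs
    using \<phi> that unfolding clone_hom_def by simp
  define \<omega> where "\<omega> t = term_op W N (op t (\<lambda>i. i))" for t
  have \<omega>: "\<omega> t \<in> variety_clone W N" if "t \<in> D" for t
    unfolding variety_clone_iff \<omega>_def
    by (intro exI[of _ "op t (\<lambda>i. i)"] conjI HOL.refl wf_op[OF that]) (auto simp: op_def)
  have "\<exists>i<N. \<phi> N (\<omega> t) = term_op SET N (Var i)" if "t \<in> D" for t
    using \<phi> \<omega>[OF that] N1 by (intro variety_clone_SET) (simp add: clone_hom_def)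
  then obtain \<iota> where \<iota>: "\<iota> t < N" "\<phi> N (\<omega> t) = term_op SET N (Var (\<iota> t))" if "t \<in> D" for t
    by metis
  have \<iota>_C': "\<iota> t = \<sigma> (\<iota> s)" if st: "(s, t, \<sigma>) \<in> C'" for s t \<sigma>
  proof -
    \<comment> \<open>An arity large enough for the variables on both sides of the identity.\<close>
    define n where "n = N + Suc (Max (insert 0 (\<sigma> ` {..<N})))"
    have \<sigma>n: "\<sigma> i < n" if "i < N" for i
    proof -
      have "\<sigma> i \<le> Max (insert 0 (\<sigma> ` {..<N}))" using that by (intro Max_ge) auto
      then show ?thesis by (simp add: n_def)
    qed
    have n: "N < n" "1 \<le> n" by (simp_all add: n_def)
    have comp: "term_op W n (op u \<tau>) = composition (free_univ W) n (\<omega> u) (map (\<lambda>i. term_op W n (Var (\<tau> i))) [0..<N])"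
      if "u \<in> D" "\<forall>i<N. \<tau> i < n" for u \<tau>
    proof -
      have "subst (\<lambda>i. Var (\<tau> i)) (op u (\<lambda>i. i)) = op u \<tau>" by (simp add: op_def comp_def)
      moreover have "vars (op u (\<lambda>i. i)) \<subseteq> {..<N}" by (auto simp: op_def)
      ultimately show ?thesis
        using composition_term_op[OF W wf_op[OF that(1)], of "\<lambda>i. i" N "\<lambda>i. Var (\<tau> i)" n] that(2)
        by (simp add: \<omega>_def)
    qed
    have img: "\<phi> n (term_op W n (op u \<tau>)) = term_op SET n (Var (\<tau> (\<iota> u)))"
      if u: "u \<in> D" and \<tau>: "\<forall>i<N. \<tau> i < n" for u \<tau>
    proof -
      have proj: "\<phi> n (term_op W n (Var j)) = term_op SET n (Var j)" if "j < n" for j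
        using \<phi> n(2) that unfolding clone_hom_def projection_eq_term_op by blast
      have "set (map (\<lambda>i. term_op W n (Var (\<tau> i))) [0..<N]) \<subseteq> variety_clone W n"
        using \<tau> by (auto simp: variety_clone_iff intro!: exI)
      then have "map (\<lambda>i. term_op W n (Var (\<tau> i))) [0..<N] \<in> nlists N (variety_clone W n)"
        by (simp add: nlists_def)
      from hom_comp[OF N1 n(2) \<omega>[OF u] this]
      have "\<phi> n (term_op W n (op u \<tau>)) = composition (free_univ SET) n (\<phi> N (\<omega> u))
          (map (\<phi> n) (map (\<lambda>i. term_op W n (Var (\<tau> i))) [0..<N]))"
        unfolding comp[OF u \<tau>] .
      also have "map (\<phi> n) (map (\<lambda>i. term_op W n (Var (\<tau> i))) [0..<N]) = map (\<lambda>i. term_op SET n (Var (\<tau> i))) [0..<N]"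
        using proj \<tau> by simp
      also have "composition (free_univ SET) n (\<phi> N (\<omega> u)) \<dots> = term_op SET n (subst (\<lambda>i. Var (\<tau> i)) (Var (\<iota> u)))"
        unfolding \<iota>(2)[OF u] using \<iota>(1)[OF u] \<tau> by (intro composition_term_op[OF wf_SET]) auto
      finally show ?thesis by simp
    qed
    have sD: "s \<in> D" and tD: "t \<in> D" using C'(1,2)[OF st] by simp_all
    have "eq_conseq W (op s \<sigma>) (op t (\<lambda>i. i))"
      by (rule conseq[OF ident_C'[OF st]])
    then have "term_op W n (op s \<sigma>) = term_op W n (op t (\<lambda>i. i))"
      using \<sigma>n n(1) by (subst term_op_eq_iff[OF W wf_op[OF sD] wf_op[OF tD]]) (auto simp: op_def)
    then have "term_op SET n (Var (\<sigma> (\<iota> s))) = term_op SET n (Var (\<iota> t))"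
      using img[OF sD, of \<sigma>] img[OF tD, of "\<lambda>i. i"] \<sigma>n n(1) by simp
    then show ?thesis
      using term_op_eq_iff[OF wf_SET, of "Var (\<sigma> (\<iota> s))" "Var (\<iota> t)" n] SET_Var_inj
        \<sigma>n[OF \<iota>(1)[OF sD]] \<iota>(1)[OF tD] n(1) by fastforce
  qed
  have "\<iota> t \<in> vars t" if "t \<in> D" for t
  proof -
    have "\<iota> t = away t (\<iota> t)" by (rule \<iota>_C') (use that in \<open>simp add: C'_def\<close>)
    then show ?thesis by (auto simp: away_def split: if_splits)
  qed
  moreover have "s \<in> D" "t \<in> D" "\<iota> t = \<sigma> (\<iota> s)" if "(s, t, \<sigma>) \<in> C" for s t \<sigma>
  proof -
    have "(s, t, \<sigma>) \<in> C'" using that by (simp add: C'_def)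
    then show "s \<in> D" "t \<in> D" "\<iota> t = \<sigma> (\<iota> s)" using C'(1,2) \<iota>_C' by blast+
  qed
  ultimately show ?thesis
    by (intro exI[of _ "\<lambda>t. if t \<in> D then \<iota> t else 0"]) auto
qed

text \<open>
  Idempotent terms are those with the diagonal of a variable. Compactness extends the choices for
  finitely many constraints between them to all constraints. The bound \<open>insert 0 (vars t)\<close> keeps
  the sets of possible values finite and also non-empty when \<open>t\<close> is closed.
\<close>

lemma non_Taylor_chooser:
  fixes V :: "'s variety"
  assumes V: "wf_variety V" and nT: "\<not> Taylor V"
  shows "\<exists>\<alpha>. chooser V (Var 0) \<alpha>"
proof -
  define K where "K = {(s, t, \<sigma>). same_diag V (Var 0) s \<and> eq_conseq V (rename \<sigma> s) t}"
  define P where "P = (\<lambda>(s, t, \<sigma> :: nat \<Rightarrow> nat). (s, t, \<lambda>i j. j = \<sigma> i)) ` K"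
  have "\<exists>\<alpha>. (\<forall>t. \<alpha> t \<in> insert 0 (vars t)) \<and> (\<forall>(s, t, R)\<in>P. R (\<alpha> s) (\<alpha> t))"
  proof (rule binary_constraints_compact)
    fix P0 assume P0: "finite P0" "P0 \<subseteq> P"
    obtain C where C: "C \<subseteq> K" "finite C" "P0 = (\<lambda>(s, t, \<sigma> :: nat \<Rightarrow> nat). (s, t, \<lambda>i j. j = \<sigma> i)) ` C"
      using finite_subset_image[OF P0(1) P0(2)[unfolded P_def]] by blast
    have "\<exists>\<alpha>. (\<forall>t. \<alpha> t \<in> insert 0 (vars t)) \<and> (\<forall>(s, t, \<sigma>)\<in>C. \<alpha> t = \<sigma> (\<alpha> s))"
      by (rule non_Taylor_finite_chooser[OF V nT C(2)]) (use C(1) in \<open>auto simp: K_def\<close>)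
    then show "\<exists>\<alpha>. (\<forall>t. \<alpha> t \<in> insert 0 (vars t)) \<and> (\<forall>(s, t, R)\<in>P0. R (\<alpha> s) (\<alpha> t))"
      unfolding C(3) by (simp add: case_prod_beta)
  qed simp
  then obtain \<alpha> where \<alpha>: "\<forall>(s, t, R)\<in>P. R (\<alpha> s) (\<alpha> t)" by (elim exE conjE)
  have "\<alpha> t = \<sigma> (\<alpha> s)" if "same_diag V (Var 0) s" "eq_conseq V (rename \<sigma> s) t" for s t \<sigma>
  proof -
    have "(s, t, \<lambda>i j. j = \<sigma> i) \<in> P" unfolding P_def K_def using that by force
    from bspec[OF \<alpha> this] show ?thesis by simp
  qed
  then have "chooser V (Var 0) \<alpha>" unfolding chooser_def by simp
  then show ?thesis by (rule exI[of "chooser V (Var 0)" \<alpha>])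
qed

section \<open>Edge-preserving maps from powers of the reflexive 3-cycle\<close>

text \<open>
  An edge-preserving map from a power of the reflexive 3-cycle to the 3-cycle. The arguments are
  arbitrary natural numbers read modulo 3, so that adding 1 to coordinates stays within the domain.
\<close>

locale cyclic_map =
  fixes F :: "('j \<Rightarrow> nat) \<Rightarrow> nat"
  assumes less_3: "F x < 3"
    and mod_3: "(\<And>j. x j mod 3 = y j mod 3) \<Longrightarrow> F x = F y"
    and edge: "(\<And>j. y j = x j \<or> y j = Suc (x j)) \<Longrightarrow> F y = F x \<or> F y = Suc (F x) mod 3"
begin

definition bump :: "'j set \<Rightarrow> ('j \<Rightarrow> nat) \<Rightarrow> 'j \<Rightarrow> nat" where
  "bump S x = (\<lambda>j. if j \<in> S then Suc (x j) else x j)"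

text \<open>
  Whether adding 1 on \<open>S\<close> changes \<open>F\<close>; the base point 0 is arbitrary by \<open>live_iff\<close>.
\<close>

definition live :: "'j set \<Rightarrow> bool" where
  "live S \<longleftrightarrow> F (bump S (\<lambda>_. 0)) \<noteq> F (\<lambda>_. 0)"

lemma edge_bump: "F (bump S x) = F x \<or> F (bump S x) = Suc (F x) mod 3"
  by (rule edge) (simp add: bump_def)

lemma bump_triple: "F (bump S (bump S (bump S x))) = F x"
  by (rule mod_3) (simp add: bump_def)

lemma cyclic_arith:
  fixes a :: nat
  assumes "a < 3" "b = a \<or> b = Suc a mod 3" "c = b \<or> c = Suc b mod 3" "a = c \<or> a = Suc c mod 3"
  shows "b = a \<and> c = a \<or> b = Suc a mod 3 \<and> c = Suc (Suc a) mod 3 \<and> b \<noteq> a"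
proof -
  have "a = 0 \<or> a = 1 \<or> a = 2" using assms(1) by auto
  then show ?thesis using assms(2-4) by auto
qed

text \<open>
  Three successive steps close up, and each adds 0 or 1 modulo 3. So all of them add the same amount.
\<close>

lemma bump_line:
  "F (bump S x) = F x \<and> F (bump S (bump S x)) = F x \<or>
   F (bump S x) = Suc (F x) mod 3 \<and> F (bump S (bump S x)) = Suc (Suc (F x)) mod 3 \<and> F (bump S x) \<noteq> F x"
  using cyclic_arith[OF less_3[of x] edge_bump[of S x] edge_bump[of S "bump S x"]]
    edge_bump[of S "bump S (bump S x)"] unfolding bump_triple by blast

text \<open>
  If \<open>F\<close> is constant on one of the two lines through \<open>x\<close> and \<open>y\<close> in direction \<open>S\<close> and rotates on the
  other, then one value is joined by edges, in the same orientation, to all three vertices of the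
  3-cycle. No vertex has this property.
\<close>

lemma live_edge:
  assumes "\<And>j. y j = x j \<or> y j = Suc (x j)"
  shows "F (bump S y) \<noteq> F y \<longleftrightarrow> F (bump S x) \<noteq> F x"
proof -
  have 1: "F y = F x \<or> F y = Suc (F x) mod 3"
    by (rule edge) (rule assms)
  have 2: "F (bump S y) = F (bump S x) \<or> F (bump S y) = Suc (F (bump S x)) mod 3"
    by (rule edge) (use assms in \<open>auto simp: bump_def\<close>)
  have 3: "F (bump S (bump S y)) = F (bump S (bump S x)) \<or> F (bump S (bump S y)) = Suc (F (bump S (bump S x))) mod 3"
    by (rule edge) (use assms in \<open>auto simp: bump_def\<close>)
  have "F x = 0 \<or> F x = 1 \<or> F x = 2" using less_3[of x] by auto
  then show ?thesis
    using 1 2 3 bump_line[of S x] bump_line[of S y] by auto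
qed

lemma live_bump: "F (bump S (bump T x)) \<noteq> F (bump T x) \<longleftrightarrow> F (bump S x) \<noteq> F x"
  by (rule live_edge) (simp add: bump_def)

text \<open>
  Modulo 3, any point is reached from any other in two edge steps; \<open>k j\<close> is the difference
  \<open>y j - x j\<close> modulo 3, written without subtraction.
\<close>

lemma reach_mod_3:
  fixes x y :: "'j \<Rightarrow> nat"
  defines "k \<equiv> \<lambda>j. (y j + 2 * x j) mod 3"
  shows "bump {j. k j = 2} (bump {j. k j \<noteq> 0} x) j mod 3 = y j mod 3"
proof -
  have "(x j + k j) mod 3 = (x j + (y j + 2 * x j)) mod 3" unfolding k_def by (rule mod_add_right_eq)
  also have "x j + (y j + 2 * x j) = y j + 3 * x j" by simp
  finally have "(x j + k j) mod 3 = y j mod 3" by (simp only: mod_mult_self2)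
  moreover have "k j = 0 \<or> k j = 1 \<or> k j = 2" unfolding k_def by linarith
  ultimately show ?thesis by (auto simp: bump_def)
qed

lemma live_iff: "live S \<longleftrightarrow> F (bump S x) \<noteq> F x"
proof -
  define k where "k j = (x j + 2 * 0) mod 3" for j
  let ?z = "bump {j. k j = 2} (bump {j. k j \<noteq> 0} (\<lambda>_. 0))"
  have eq: "?z j mod 3 = x j mod 3" for j
    using reach_mod_3[of x "\<lambda>_. 0" j] unfolding k_def .
  have "live S \<longleftrightarrow> F (bump S ?z) \<noteq> F ?z" by (simp only: live_bump live_def)
  moreover have "F ?z = F x" by (rule mod_3) (rule eq)
  moreover have "F (bump S ?z) = F (bump S x)"
  proof (rule mod_3)
    fix j
    have "Suc (?z j) mod 3 = Suc (x j) mod 3" by (metis eq mod_Suc_eq)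
    then show "bump S ?z j mod 3 = bump S x j mod 3" using eq[of j] by (simp only: bump_def[of S] split: if_split) simp
  qed
  ultimately show ?thesis by simp
qed

lemma F_bump: "F (bump S x) = (if live S then Suc (F x) mod 3 else F x)"
  using edge_bump[of S x] live_iff[of S x] by (cases "live S") simp_all

text \<open>
  Adding 1 on two disjoint live sets would move \<open>F\<close> by 2, but it is a step along a single edge.
\<close>

lemma live_disjoint:
  assumes "S1 \<inter> S2 = {}"
  shows "live (S1 \<union> S2) \<longleftrightarrow> live S1 \<or> live S2" "\<not> (live S1 \<and> live S2)"
proof -
  let ?o = "\<lambda>_ :: 'j. 0 :: nat"
  have "bump (S1 \<union> S2) ?o = bump S2 (bump S1 ?o)"
    using assms by (auto simp: bump_def fun_eq_iff)
  then have "F (bump (S1 \<union> S2) ?o) = F (bump S2 (bump S1 ?o))" by simp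
  then have "(if live (S1 \<union> S2) then Suc (F ?o) mod 3 else F ?o) =
      (if live S2 then Suc (if live S1 then Suc (F ?o) mod 3 else F ?o) mod 3
       else if live S1 then Suc (F ?o) mod 3 else F ?o)"
    unfolding F_bump .
  moreover have "F ?o = 0 \<or> F ?o = 1 \<or> F ?o = 2" using less_3[of ?o] by auto
  ultimately show "live (S1 \<union> S2) \<longleftrightarrow> live S1 \<or> live S2" "\<not> (live S1 \<and> live S2)"
    by (cases "live S1"; cases "live S2"; cases "live (S1 \<union> S2)"; auto)+
qed

lemma depends_on_live:
  assumes B: "live B" and xy: "\<And>j. j \<in> B \<Longrightarrow> x j = y j"
  shows "F x = F y"
proof -
  define k where "k j = (y j + 2 * x j) mod 3" for j
  let ?S1 = "{j. k j \<noteq> 0}" and ?S2 = "{j. k j = 2}"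
  have "k j = 0" if "j \<in> B" for j using xy[OF that] by (simp add: k_def)
  then have "B \<inter> ?S1 = {}" "B \<inter> ?S2 = {}" by auto
  then have "\<not> live ?S1" "\<not> live ?S2"
    using live_disjoint(2) B by blast+
  then have "F (bump ?S2 (bump ?S1 x)) = F x"
    using live_iff[of ?S1 x] live_iff[of ?S2 "bump ?S1 x"] by simp
  moreover have "F (bump ?S2 (bump ?S1 x)) = F y"
    by (rule mod_3) (rule reach_mod_3[of y x, folded k_def])
  ultimately show ?thesis by simp
qed

lemma live_block:
  fixes B :: "nat \<Rightarrow> 'j set"
  assumes "live (\<Union>i<n. B i)" "\<And>i j. i \<noteq> j \<Longrightarrow> B i \<inter> B j = {}"
  shows "\<exists>i<n. live (B i)"
  using assms(1)
proof (induction n)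
  case 0
  then show ?case by (simp add: live_def bump_def)
next
  case (Suc n)
  have "B i \<inter> B n = {}" if "i < n" for i using assms(2)[of i n] that by simp
  then have "(\<Union>i<n. B i) \<inter> B n = {}" by blast
  moreover have "(\<Union>i<Suc n. B i) = (\<Union>i<n. B i) \<union> B n" by (auto simp: lessThan_Suc)
  ultimately have "live (\<Union>i<n. B i) \<or> live (B n)" using Suc.prems live_disjoint(1) by metis
  then show ?case using Suc.IH less_Suc_eq by blast
qed

end

text \<open>
  Adding 1 to all coordinates of the first \<open>n\<close> arguments changes \<open>F\<close> by idempotence, so the block
  of coordinates of some argument \<open>i\<close> is live. Then \<open>F\<close> depends on this block only, and idempotence identifies it.
\<close>

lemma cyclic_map_idempotent:
  fixes F :: "(nat \<times> 'h \<Rightarrow> nat) \<Rightarrow> nat"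
  assumes "cyclic_map F"
    and dep: "\<And>x y. (\<And>i k. i < n \<Longrightarrow> x (i, k) = y (i, k)) \<Longrightarrow> F x = F y"
    and idem: "\<And>z. F (\<lambda>(i, k). z k) = z h mod 3"
  shows "\<exists>i<n. \<forall>x. F x = x (i, h) mod 3"
proof -
  interpret cyclic_map F by (rule assms(1))
  let ?B = "\<lambda>i. {i} \<times> (UNIV :: 'h set)"
  have "F (bump (\<Union>i<n. ?B i) (\<lambda>_. 0)) = F (\<lambda>(i, k). 1)"
    by (rule dep) (simp add: bump_def)
  then have "F (bump (\<Union>i<n. ?B i) (\<lambda>_. 0)) = 1" using idem[of "\<lambda>_. 1"] by simp
  moreover have "F (\<lambda>_. 0) = 0" using idem[of "\<lambda>_. 0"] by (simp add: case_prod_unfold)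
  ultimately have "live (\<Union>i<n. ?B i)" by (simp add: live_def)
  then obtain i where i: "i < n" "live (?B i)"
    using live_block[of ?B n] by blast
  have "F x = x (i, h) mod 3" for x
  proof -
    have "F x = F (\<lambda>(j, k). x (i, k))" by (rule depends_on_live[OF i(2)]) auto
    then show ?thesis using idem[of "\<lambda>k. x (i, k)"] by simp
  qed
  then show ?thesis using i(1) by blast
qed

section \<open>Term operations on a union of powers of the 3-cycle\<close>

lemma eval_preserves:
  assumes "\<forall>f\<in>opsyms V. preserves (arity V f) (I f) R" "\<And>k. (d k, e k) \<in> R" "wf_trm V t"
  shows "(eval I d t, eval I e t) \<in> R"
  using assms(3)
proof (induction t)
  case (Op f ts)
  have "preserves (arity V f) (I f) R" using assms(1) Op.prems by simp
  moreover have "(eval I d (ts ! i), eval I e (ts ! i)) \<in> R" if "i < length ts" for i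
    using Op.IH[OF nth_mem[OF that]] Op.prems that by (simp add: list_all_length)
  ultimately show ?case using Op.prems by (simp add: preserves_def)
qed (simp add: assms(2))

lemma C3_vert_iff: "a \<in> pverts C3 \<longleftrightarrow> a < 3"
  by (auto simp: C3_def)

lemma C3_arc_iff: "(a, b) \<in> parcs C3 \<longleftrightarrow> a < 3 \<and> (b = a \<or> b = Suc a mod 3)"
proof -
  have "a < 3 \<longleftrightarrow> a = 0 \<or> a = 1 \<or> a = 2" by auto
  then show ?thesis unfolding C3_def by auto
qed

text \<open>
  An algebra on a disjoint union of powers of the 3-cycle, with a component \<open>t0\<close> and a coordinate \<open>h0\<close>
  of this component.
\<close>

locale C3_union =
  fixes V :: "'s variety" and T :: "'t set" and H :: "'t \<Rightarrow> 'h set"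
    and I :: "'s \<Rightarrow> ('t \<times> ('h \<Rightarrow> nat)) list \<Rightarrow> 't \<times> ('h \<Rightarrow> nat)" and t0 :: 't and h0 :: 'h
  assumes V: "wf_variety V"
    and alg: "algebra_of V (pverts (disjoint_union T (\<lambda>t. digraph_power C3 (H t)))) I"
    and pres: "\<forall>f\<in>opsyms V. preserves (arity V f) (I f) (parcs (disjoint_union T (\<lambda>t. digraph_power C3 (H t))))"
    and t0: "t0 \<in> T" and h0: "h0 \<in> H t0"
begin

abbreviation D where "D \<equiv> disjoint_union T (\<lambda>t. digraph_power C3 (H t))"

abbreviation points where "points \<equiv> H t0 \<rightarrow>\<^sub>E pverts C3"

lemma vert_iff: "(t0, u) \<in> pverts D \<longleftrightarrow> u \<in> points"
  using t0 by (simp add: disjoint_union_def digraph_power_def)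

lemma arc_iff:
  "((t0, u), (t, v)) \<in> parcs D \<longleftrightarrow> t = t0 \<and> u \<in> points \<and> v \<in> points \<and> (\<forall>h\<in>H t0. (u h, v h) \<in> parcs C3)"
  using t0 by (auto simp: disjoint_union_def digraph_power_def)

lemma arc_same_component: "(p, q) \<in> parcs D \<Longrightarrow> fst p = fst q"
  by (auto simp: disjoint_union_def)

lemma eval_arc:
  assumes "wf_trm V t" "\<And>k. x k \<in> points" "\<And>k. y k \<in> points" "\<And>k h. h \<in> H t0 \<Longrightarrow> (x k h, y k h) \<in> parcs C3"
  shows "(eval I (\<lambda>k. (t0, x k)) t, eval I (\<lambda>k. (t0, y k)) t) \<in> parcs D"
  by (rule eval_preserves[OF pres _ assms(1)]) (simp add: arc_iff assms(2-4))

lemma eval_vert: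
  assumes "wf_trm V t" "\<And>k. x k \<in> points"
  shows "eval I (\<lambda>k. (t0, x k)) t \<in> pverts D"
  by (rule eval_in_universe[OF alg _ assms(1)]) (use assms(2) in \<open>auto simp: vert_iff simp del: PiE_iff\<close>)

text \<open>
  At the coordinate \<open>h0\<close> of the component \<open>t0\<close>, the term acts as a projection to its variable \<open>i\<close>.
\<close>

definition acts :: "('s, nat) trm \<Rightarrow> nat \<Rightarrow> bool" where
  "acts t i \<longleftrightarrow> (\<forall>x. (\<forall>k. x k \<in> points) \<longrightarrow>
    (\<exists>u\<in>points. eval I (\<lambda>k. (t0, x k)) t = (t0, u) \<and> u h0 = x i h0))"

lemma acts_unique:
  assumes "acts t i" "acts t j" shows "i = j"
proof (rule ccontr)
  assume ne: "i \<noteq> j"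
  let ?x = "\<lambda>k. \<lambda>h\<in>H t0. if k = i then 1 else 0 :: nat"
  have "\<forall>k. ?x k \<in> points" by (auto simp: C3_vert_iff)
  then have "?x i h0 = ?x j h0"
    using assms[unfolded acts_def, THEN spec[of _ ?x]] by fastforce
  then show False using ne h0 by simp
qed

lemma acts_cong:
  assumes "eq_conseq V s t" shows "acts s i \<longleftrightarrow> acts t i"
proof -
  have "eval I (\<lambda>k. (t0, x k)) s = eval I (\<lambda>k. (t0, x k)) t" if "\<forall>k. x k \<in> points" for x
    by (rule eq_conseq_sound[OF alg _ assms]) (use that in \<open>auto simp: vert_iff simp del: PiE_iff\<close>)
  then show ?thesis unfolding acts_def by simp
qed

lemma acts_Var: "acts (Var i) i"
  by (simp add: acts_def)

lemma acts_subst: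
  assumes t: "acts t i" "vars t \<subseteq> {..<m}" "i < m" and \<sigma>: "\<And>k. k < m \<Longrightarrow> acts (\<sigma> k) (j k)"
  shows "acts (subst \<sigma> t) (j i)"
  unfolding acts_def
proof (intro allI impI)
  fix x :: "nat \<Rightarrow> 'h \<Rightarrow> nat" assume x: "\<forall>k. x k \<in> points"
  have "\<forall>k. \<exists>u\<in>points. k < m \<longrightarrow> eval I (\<lambda>k. (t0, x k)) (\<sigma> k) = (t0, u) \<and> u h0 = x (j k) h0"
    using \<sigma> x unfolding acts_def by metis
  then obtain y where y: "\<forall>k. y k \<in> points"
      "\<And>k. k < m \<Longrightarrow> eval I (\<lambda>k. (t0, x k)) (\<sigma> k) = (t0, y k) \<and> y k h0 = x (j k) h0"
    by metis
  have "eval I (\<lambda>k. (t0, x k)) (subst \<sigma> t) = eval I (\<lambda>k. (t0, y k)) t"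
    unfolding eval_subst using t(2) y(2) by (intro eval_cong) auto
  then show "\<exists>u\<in>points. eval I (\<lambda>k. (t0, x k)) (subst \<sigma> t) = (t0, u) \<and> u h0 = x (j i) h0"
    using t(1) y(1) y(2)[OF t(3)] unfolding acts_def by metis
qed

lemma eval_idempotent:
  assumes "eq_conseq V (rename (\<lambda>_. 0) t) (Var 0)" "u \<in> points"
  shows "eval I (\<lambda>_. (t0, u)) t = (t0, u)"
proof -
  have "eval I (\<lambda>_ :: nat. (t0, u)) (rename (\<lambda>_. 0) t) = eval I (\<lambda>_ :: nat. (t0, u)) (Var 0)"
    by (rule eq_conseq_sound[OF alg _ assms(1)]) (use assms(2) in \<open>auto simp: vert_iff simp del: PiE_iff\<close>)
  then show ?thesis by (simp add: eval_subst)
qed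

text \<open>
  Any point \<open>x\<close> of a power and the constant point 0 have a common out-neighbour \<open>m\<close>: the vertices 0
  and 2 have an edge to 0, the vertex 1 has a loop, and 0 has edges to 0 and 1. As the value of an
  idempotent term at constant points is known, edges keep its other values in the same component.
\<close>

lemma eval_component:
  assumes t: "wf_trm V t" "eq_conseq V (rename (\<lambda>_. 0) t) (Var 0)" and x: "\<And>k. x k \<in> points"
  shows "\<exists>u\<in>points. eval I (\<lambda>k. (t0, x k)) t = (t0, u)"
proof -
  let ?o = "\<lambda>h\<in>H t0. 0 :: nat"
  let ?m = "\<lambda>k. \<lambda>h\<in>H t0. if x k h = 1 then 1 else 0 :: nat"
  have val: "x k h = 0 \<or> x k h = 1 \<or> x k h = 2" if "h \<in> H t0" for k h
    using PiE_mem[OF x that, of k] by (auto simp: C3_vert_iff)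
  have m: "?m k \<in> points" for k by (auto simp: C3_vert_iff)
  have "(x k h, ?m k h) \<in> parcs C3" if "h \<in> H t0" for k h
    using val[OF that, of k] that by (auto simp: C3_arc_iff)
  then have 1: "(eval I (\<lambda>k. (t0, x k)) t, eval I (\<lambda>k. (t0, ?m k)) t) \<in> parcs D"
    by (rule eval_arc[OF t(1) x m])
  have 2: "(eval I (\<lambda>_. (t0, ?o)) t, eval I (\<lambda>k. (t0, ?m k)) t) \<in> parcs D"
    by (rule eval_arc[OF t(1)]) (auto simp: C3_arc_iff C3_vert_iff)
  have 3: "eval I (\<lambda>_. (t0, ?o)) t = (t0, ?o)"
    by (rule eval_idempotent[OF t(2)]) (auto simp: C3_vert_iff)
  have "fst (eval I (\<lambda>k. (t0, x k)) t) = t0"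
    using arc_same_component[OF 1] arc_same_component[OF 2] unfolding 3 by simp
  then obtain u where u: "eval I (\<lambda>k. (t0, x k)) t = (t0, u)" by (metis prod.collapse)
  moreover have "u \<in> points"
    using eval_vert[of t x, OF t(1) x] unfolding u vert_iff .
  ultimately show ?thesis by simp
qed

lemma idempotent_acts:
  assumes t: "wf_trm V t" "vars t \<subseteq> {..<n}" "eq_conseq V (rename (\<lambda>_. 0) t) (Var 0)"
  shows "\<exists>i<n. acts t i"
proof -
  \<comment> \<open>The coordinates of all arguments together index one large power of the 3-cycle.\<close>
  define red where "red x k = (\<lambda>h\<in>H t0. x (k, h) mod 3)" for x :: "nat \<times> 'h \<Rightarrow> nat" and k
  define F where "F x = snd (eval I (\<lambda>k. (t0, red x k)) t) h0" for x
  have red: "red x k \<in> points" for x k unfolding red_def by (auto simp: C3_vert_iff)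
  have ev: "eval I (\<lambda>k. (t0, red x k)) t = (t0, snd (eval I (\<lambda>k. (t0, red x k)) t))"
      "snd (eval I (\<lambda>k. (t0, red x k)) t) \<in> points" for x
    using eval_component[OF t(1,3), of "red x"] red by force+
  have cyc: "cyclic_map F"
  proof
    fix x
    show "F x < 3" using PiE_mem[OF ev(2) h0, of x] by (simp add: F_def C3_vert_iff)
  next
    fix x y :: "nat \<times> 'h \<Rightarrow> nat" assume "\<And>j. x j mod 3 = y j mod 3"
    then have "red x = red y" by (simp add: red_def fun_eq_iff)
    then show "F x = F y" by (simp add: F_def)
  next
    fix x y :: "nat \<times> 'h \<Rightarrow> nat" assume step: "\<And>j. y j = x j \<or> y j = Suc (x j)"
    have "y j mod 3 = x j mod 3 \<or> y j mod 3 = Suc (x j mod 3) mod 3" for j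
      using step[of j] by (auto simp: mod_Suc_eq)
    then have "(red x k h, red y k h) \<in> parcs C3" if "h \<in> H t0" for k h
      using that by (simp add: red_def C3_arc_iff)
    then have "(eval I (\<lambda>k. (t0, red x k)) t, eval I (\<lambda>k. (t0, red y k)) t) \<in> parcs D"
      by (intro eval_arc[OF t(1) red red])
    then have "(F x, F y) \<in> parcs C3"
      unfolding F_def using h0 ev(1)[of x] ev(1)[of y] by (metis arc_iff)
    then show "F y = F x \<or> F y = Suc (F x) mod 3" by (simp add: C3_arc_iff)
  qed
  have "\<exists>i<n. \<forall>x. F x = x (i, h0) mod 3"
  proof (rule cyclic_map_idempotent[OF cyc])
    fix x y :: "nat \<times> 'h \<Rightarrow> nat" assume eq: "\<And>i k. i < n \<Longrightarrow> x (i, k) = y (i, k)"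
    have "eval I (\<lambda>k. (t0, red x k)) t = eval I (\<lambda>k. (t0, red y k)) t"
      using t(2) eq by (intro eval_cong) (auto simp: red_def)
    then show "F x = F y" by (simp add: F_def)
  next
    fix z :: "'h \<Rightarrow> nat"
    have "red (\<lambda>(i, k). z k) = (\<lambda>_. \<lambda>h\<in>H t0. z h mod 3)"
      by (rule ext) (simp add: red_def)
    moreover have "(\<lambda>h\<in>H t0. z h mod 3) \<in> points" using red[of "\<lambda>(i, k). z k" 0] by (simp only: red_def prod.case)
    ultimately show "F (\<lambda>(i, k). z k) = z h0 mod 3"
      unfolding F_def using eval_idempotent[OF t(3)] h0 by simp
  qed
  then obtain i where i: "i < n" "\<And>x. F x = x (i, h0) mod 3" by blast
  have "acts t i"
    unfolding acts_def
  proof (intro allI impI)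
    fix x :: "nat \<Rightarrow> 'h \<Rightarrow> nat" assume x: "\<forall>k. x k \<in> points"
    let ?x = "\<lambda>(k, h). x k h"
    have "x k h mod 3 = x k h" if "h \<in> H t0" for k h
      using PiE_mem[OF x[rule_format] that, of k] by (simp add: C3_vert_iff)
    then have "red ?x k = x k" for k
      using x by (intro PiE_ext[OF red, of "x k"]) (auto simp: red_def)
    then have "red ?x = x" by blast
    moreover have "x i h0 mod 3 = x i h0"
      using PiE_mem[OF x[rule_format] h0, of i] by (simp add: C3_vert_iff)
    ultimately have "snd (eval I (\<lambda>k. (t0, x k)) t) h0 = x i h0"
      using i(2)[of ?x] by (simp add: F_def)
    then show "\<exists>u\<in>points. eval I (\<lambda>k. (t0, x k)) t = (t0, u) \<and> u h0 = x i h0"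
      using eval_component[OF t(1,3), of x] x by (metis snd_conv)
  qed
  then show ?thesis using i(1) by blast
qed

text \<open>
  Given an idempotent condition interpreted in \<open>V\<close>, every operation of its clone is mapped to the
  projection as which its image acts at \<open>h0\<close>. Substitution of terms corresponds to composition of
  these projections, so this is an interpretation in the variety of sets.
\<close>

lemma not_Taylor: "\<not> Taylor V"
proof
  assume "Taylor V"
  then obtain a M \<phi> where M: "strong_Maltsev a M" "idempotent_variety (defined_by a M)" "\<not> admits SET a M"
    and \<phi>: "clone_hom (free_univ (defined_by a M)) (variety_clone (defined_by a M)) (free_univ V) (variety_clone V) \<phi>"
    unfolding Taylor_def admits_def[of V] interprets_def[of _ V] by blast
  define W where "W = defined_by a M"
  have W: "wf_variety W" using M(1) by (simp add: strong_Maltsev_def W_def)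
  note \<phi> = \<phi>[folded W_def]
  have hom_in: "\<phi> n f \<in> variety_clone V n" if "1 \<le> n" "f \<in> variety_clone W n" for n f
    using \<phi> that unfolding clone_hom_def by simp
  have hom_proj: "\<phi> n (projection (free_univ W) n i) = projection (free_univ V) n i" if "1 \<le> n" "i < n" for n i
    using \<phi> that unfolding clone_hom_def by simp
  have hom_comp: "\<phi> n (composition (free_univ W) n f gs) = composition (free_univ V) n (\<phi> m f) (map (\<phi> n) gs)"
    if "1 \<le> m" "1 \<le> n" "f \<in> variety_clone W m" "gs \<in> nlists m (variety_clone W n)" for m n f gs
    using \<phi> that unfolding clone_hom_def by simp
  note clone = is_clone_variety_clone[OF W, unfolded is_clone_def]
  \<comment> \<open>Idempotence is the equation between \<open>f\<close> composed with equal projections and a projection.\<close>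
  have rep_idem: "eq_conseq V (rename (\<lambda>_. 0) s) (Var 0)"
    if n: "1 \<le> n" and f: "f \<in> variety_clone W n" and s: "\<phi> n f = term_op V n s" "wf_trm V s" "vars s \<subseteq> {..<n}" for n f s
  proof -
    let ?p = "projection (free_univ W) 1 0"
    have p: "?p \<in> variety_clone W 1" using clone by simp
    have "composition (free_univ W) 1 f (replicate n ?p) = ?p"
      unfolding composition_def projection_def[of "free_univ W" 1 0]
    proof (rule restrict_ext)
      fix xs assume xs: "xs \<in> nlists 1 (free_univ W)"
      then have "xs ! 0 \<in> free_univ W" by (auto simp: nlists_def)
      then have "f (replicate n (xs ! 0)) = xs ! 0"
        using M(2) f n unfolding W_def[symmetric] idempotent_variety_def by blast
      then show "f (map (\<lambda>g. g xs) (replicate n (\<lambda>xs\<in>nlists 1 (free_univ W). xs ! 0))) = xs ! 0"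
        using xs by simp
    qed
    moreover have "replicate n ?p \<in> nlists n (variety_clone W 1)" using p by (auto simp: nlists_def)
    ultimately have "composition (free_univ V) 1 (\<phi> n f) (map (\<phi> 1) (replicate n ?p)) = \<phi> 1 ?p"
      using hom_comp[OF n le_refl f] by metis
    moreover have "map (\<phi> 1) (replicate n ?p) = map (\<lambda>_. term_op V 1 (Var 0)) [0..<n]"
      using hom_proj[of 1 0] by (simp add: projection_eq_term_op map_replicate_const)
    ultimately have "composition (free_univ V) 1 (term_op V n s) (map (\<lambda>_. term_op V 1 (Var 0)) [0..<n]) = term_op V 1 (Var 0)"
      using hom_proj[of 1 0] by (simp add: projection_eq_term_op s(1))
    then have "term_op V 1 (rename (\<lambda>_. 0) s) = term_op V 1 (Var 0)"
      using composition_term_op[OF V s(2,3), of "\<lambda>_. Var 0" 1] by simp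
    then show ?thesis
      by (subst (asm) term_op_eq_iff[OF V]) (auto simp: s(2) vars_subst)
  qed
  define acts_op where "acts_op n g i \<longleftrightarrow>
    i < n \<and> (\<exists>s. g = term_op V n s \<and> wf_trm V s \<and> vars s \<subseteq> {..<n} \<and> acts s i)" for n g i
  have ex: "\<exists>i. acts_op n (\<phi> n f) i" if nf: "1 \<le> n" "f \<in> variety_clone W n" for n f
  proof -
    obtain s where s: "\<phi> n f = term_op V n s" "wf_trm V s" "vars s \<subseteq> {..<n}"
      using hom_in[OF nf] unfolding variety_clone_iff by blast
    then obtain i where "i < n" "acts s i" using idempotent_acts[OF s(2,3) rep_idem[OF nf s]] by blast
    then show ?thesis using s unfolding acts_op_def by blast
  qed
  have rep: "acts s i"
    if op: "acts_op n g i" and s: "g = term_op V n s" "wf_trm V s" "vars s \<subseteq> {..<n}" for n g i s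
  proof -
    obtain s' where s': "g = term_op V n s'" "wf_trm V s'" "vars s' \<subseteq> {..<n}" "acts s' i"
      using op unfolding acts_op_def by blast
    then have "eq_conseq V s' s" using term_op_eq_iff[OF V s'(2) s(2) s'(3) s(3)] s(1) by simp
    then show ?thesis using s'(4) acts_cong by simp
  qed
  have unique: "i = j" if "acts_op n g i" "acts_op n g j" for n g i j
    using that rep[OF that(2)] acts_unique unfolding acts_op_def[of n g i] by blast
  define index where "index n f = (SOME i. acts_op n (\<phi> n f) i)" for n f
  have index: "acts_op n (\<phi> n f) (index n f)" if "1 \<le> n" "f \<in> variety_clone W n" for n f
    unfolding index_def by (rule someI_ex[OF ex[OF that]])
  define \<psi> where "\<psi> n f = term_op SET n (Var (index n f))" for n f
  have "clone_hom (free_univ W) (variety_clone W) (free_univ SET) (variety_clone SET) \<psi>"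
    unfolding clone_hom_def
  proof (intro conjI allI impI ballI)
    fix n :: nat and f assume nf: "1 \<le> n" "f \<in> variety_clone W n"
    show "\<psi> n f \<in> variety_clone SET n"
      unfolding variety_clone_iff \<psi>_def
      by (rule exI[of _ "Var (index n f)"]) (use index[OF nf] in \<open>simp add: acts_op_def\<close>)
  next
    fix n i :: nat assume n: "1 \<le> n" and i: "i < n"
    have p: "projection (free_univ W) n i \<in> variety_clone W n" using clone n i by simp
    have "acts_op n (\<phi> n (projection (free_univ W) n i)) i"
      unfolding acts_op_def hom_proj[OF n i] unfolding projection_eq_term_op
      by (rule conjI[OF i], rule exI[of _ "Var i"]) (use i acts_Var in simp)
    then have "index n (projection (free_univ W) n i) = i" using unique[OF index[OF n p]] by simp
    then show "\<psi> n (projection (free_univ W) n i) = projection (free_univ SET) n i"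
      by (simp add: \<psi>_def projection_eq_term_op)
  next
    fix m n :: nat and f gs
    assume m: "1 \<le> m" and n: "1 \<le> n" and f: "f \<in> variety_clone W m" and gs: "gs \<in> nlists m (variety_clone W n)"
    have len: "length gs = m" using gs by (simp add: nlists_def)
    have g: "gs ! k \<in> variety_clone W n" if "k < m" for k
      using gs len that by (auto simp: nlists_def)
    obtain t where t: "\<phi> m f = term_op V m t" "wf_trm V t" "vars t \<subseteq> {..<m}"
      using hom_in[OF m f] unfolding variety_clone_iff by blast
    have \<phi>gs: "map (\<phi> n) gs \<in> nlists m (variety_clone V n)"
      using gs hom_in[OF n] by (auto simp: nlists_def)
    obtain \<sigma> where \<sigma>: "map (\<phi> n) gs = map (\<lambda>i. term_op V n (\<sigma> i)) [0..<m]"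
        "\<And>i. wf_trm V (\<sigma> i)" "\<And>i. vars (\<sigma> i) \<subseteq> {..<n}"
      by (rule variety_clone_listE[OF V \<phi>gs n], rule that) auto
    have \<sigma>k: "\<phi> n (gs ! k) = term_op V n (\<sigma> k)" if "k < m" for k
      using arg_cong[OF \<sigma>(1), of "\<lambda>xs. xs ! k"] len that by simp
    have im: "index m f < m" using index[OF m f] by (simp add: acts_op_def)
    have "acts (subst \<sigma> t) (index n (gs ! index m f))"
    proof (rule acts_subst[OF rep[OF index[OF m f] t] t(3) im, where j = "\<lambda>k. index n (gs ! k)"])
      show "acts (\<sigma> k) (index n (gs ! k))" if "k < m" for k
        by (rule rep[OF index[OF n g[OF that]] \<sigma>k[OF that] \<sigma>(2,3)])
    qed
    moreover have comp: "\<phi> n (composition (free_univ W) n f gs) = term_op V n (subst \<sigma> t)"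
      unfolding hom_comp[OF m n f gs] t(1) \<sigma>(1)
      by (rule composition_term_op[OF V t(2,3)]) (simp add: \<sigma>)
    moreover have "wf_trm V (subst \<sigma> t)" "vars (subst \<sigma> t) \<subseteq> {..<n}"
      using wf_subst[OF t(2) \<sigma>(2)] \<sigma>(3) by (auto simp: vars_subst)
    ultimately have "acts_op n (\<phi> n (composition (free_univ W) n f gs)) (index n (gs ! index m f))"
      unfolding acts_op_def using index[OF n g[OF im]] by (auto simp: acts_op_def)
    moreover have "composition (free_univ W) n f gs \<in> variety_clone W n"
      using clone m n f gs by simp
    ultimately have "index n (composition (free_univ W) n f gs) = index n (gs ! index m f)"
      using unique[OF index[OF n]] by blast
    then have "\<psi> n (composition (free_univ W) n f gs) = term_op SET n (Var (index n (gs ! index m f)))"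
      by (simp add: \<psi>_def)
    also have "\<dots> = composition (free_univ SET) n (\<psi> m f) (map (\<lambda>k. term_op SET n (Var (index n (gs ! k)))) [0..<m])"
      unfolding \<psi>_def using im index[OF n g]
      by (subst composition_term_op[OF wf_SET]) (auto simp: acts_op_def)
    also have "map (\<lambda>k. term_op SET n (Var (index n (gs ! k)))) [0..<m] = map (\<psi> n) gs"
      by (rule nth_equalityI) (simp_all add: len \<psi>_def)
    finally show "\<psi> n (composition (free_univ W) n f gs) = composition (free_univ SET) n (\<psi> m f) (map (\<psi> n) gs)" .
  qed
  then show False using M(3) unfolding admits_def interprets_def W_def[symmetric] by blast
qed

end

lemma compatible_imp_not_Taylor:
  assumes V: "wf_variety V" and H: "\<exists>t\<in>T. H t \<noteq> {}"
    and D: "compatible_digraph V (disjoint_union T (\<lambda>t. digraph_power C3 (H t)))"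
  shows "\<not> Taylor V"
proof -
  obtain t0 h0 where th: "t0 \<in> T" "h0 \<in> H t0" using H by blast
  obtain I where "algebra_of V (pverts (disjoint_union T (\<lambda>t. digraph_power C3 (H t)))) I"
      "\<forall>f\<in>opsyms V. preserves (arity V f) (I f) (parcs (disjoint_union T (\<lambda>t. digraph_power C3 (H t))))"
    using D unfolding compatible_digraph_def by blast
  then interpret C3_union V T H I t0 h0 using V th by unfold_locales
  show ?thesis by (rule not_Taylor)
qed

section \<open>The characterization of non-Taylor varieties\<close>

theorem lemma4p2:
  fixes V :: "'s variety"
  assumes "wf_variety V"
  shows
    "(\<not> Taylor V \<longleftrightarrow>
       (\<exists>(T :: ('s, nat) trm set set) (H :: ('s, nat) trm set \<Rightarrow> ('s, nat) trm set set).
          T \<noteq> {} \<and> (\<exists>t\<in>T. H t \<noteq> {}) \<and>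
          compatible_digraph V (disjoint_union T (\<lambda>t. digraph_power C3 (H t)))))
     \<and>
     (\<forall>(T :: 't set) (H :: 't \<Rightarrow> 'h set).
        T \<noteq> {} \<and> (\<exists>t\<in>T. H t \<noteq> {}) \<and>
        compatible_digraph V (disjoint_union T (\<lambda>t. digraph_power C3 (H t)))
        \<longrightarrow> \<not> Taylor V)
     \<and>
     (locally_finite V \<and> \<not> Taylor V \<longrightarrow>
       (\<exists>(T :: ('s, nat) trm set set) (H :: ('s, nat) trm set \<Rightarrow> ('s, nat) trm set set).
          T \<noteq> {} \<and> (\<exists>t\<in>T. H t \<noteq> {}) \<and> finite T \<and> (\<forall>t\<in>T. finite (H t)) \<and>
          compatible_digraph V (disjoint_union T (\<lambda>t. digraph_power C3 (H t)))))"
proof (intro conjI iffI allI impI)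
  let ?T = "diagonals V" and ?H = "\<lambda>c. profiles V (rep c)"
  have compat: "compatible_digraph V (disjoint_union ?T (\<lambda>c. digraph_power C3 (?H c)))"
    by (rule compatible_power_digraph[OF assms]) (simp add: C3_def)
  have ne: "\<exists>c\<in>?T. ?H c \<noteq> {}" if nT: "\<not> Taylor V"
  proof -
    let ?c = "term_class V (rename (\<lambda>_. 0) (Var 0))"
    have c: "same_diag V (Var 0) (rep ?c)" "?c \<in> ?T"
      by (rule rep_term_class[OF assms], simp)+
    obtain \<alpha> where "chooser V (Var 0) \<alpha>" by (rule exE[OF non_Taylor_chooser[OF assms nT]])
    then have "profile V (Var 0) \<alpha> \<in> ?H ?c"
      unfolding profiles_cong_diag[OF c(1), symmetric] by (simp add: profiles_def)
    then show ?thesis using c(2) by blast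
  qed
  {
    assume nT: "\<not> Taylor V"
    show "\<exists>(T :: ('s, nat) trm set set) (H :: ('s, nat) trm set \<Rightarrow> ('s, nat) trm set set).
        T \<noteq> {} \<and> (\<exists>t\<in>T. H t \<noteq> {}) \<and> compatible_digraph V (disjoint_union T (\<lambda>t. digraph_power C3 (H t)))"
      by (rule exI[of _ ?T], rule exI[of _ ?H]) (use compat ne[OF nT] in blast)
  next
    assume "locally_finite V \<and> \<not> Taylor V"
    then have lf: "locally_finite V" and nT: "\<not> Taylor V" by simp_all
    show "\<exists>(T :: ('s, nat) trm set set) (H :: ('s, nat) trm set \<Rightarrow> ('s, nat) trm set set).
        T \<noteq> {} \<and> (\<exists>t\<in>T. H t \<noteq> {}) \<and> finite T \<and> (\<forall>t\<in>T. finite (H t)) \<and>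
        compatible_digraph V (disjoint_union T (\<lambda>t. digraph_power C3 (H t)))"
      by (rule exI[of _ ?T], rule exI[of _ ?H])
        (use compat ne[OF nT] finite_diagonals[OF assms lf] finite_profiles[OF assms lf] in blast)
  }
next
  {
    assume "\<exists>(T :: ('s, nat) trm set set) (H :: ('s, nat) trm set \<Rightarrow> ('s, nat) trm set set).
        T \<noteq> {} \<and> (\<exists>t\<in>T. H t \<noteq> {}) \<and> compatible_digraph V (disjoint_union T (\<lambda>t. digraph_power C3 (H t)))"
    then show "\<not> Taylor V" by (elim exE conjE) (rule compatible_imp_not_Taylor[OF assms])
  next
    fix T :: "'t set" and H :: "'t \<Rightarrow> 'h set"
    assume "T \<noteq> {} \<and> (\<exists>t\<in>T. H t \<noteq> {}) \<and>
      compatible_digraph V (disjoint_union T (\<lambda>t. digraph_power C3 (H t)))"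
    then show "\<not> Taylor V" by (elim exE conjE) (rule compatible_imp_not_Taylor[OF assms])
  }
qed

end
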